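(* Let $\mathcal{R}$ be right amenable, let $\mathcal{F}$ be a right Følner net in $\mathcal{R}$, let $M$ be infinite, let $X$ be a non-empty subshift of $Q^M$, let $Y$ be a strongly irreducible subshift of $Q^M$, and let $\Delta$ be a local map from $X$ to $Y$ that is not surjective. Then $\mathrm{ent}_{\mathcal{F}}(\Delta(X)) < \mathrm{ent}_{\mathcal{F}}(Y)$.
   Context: Setting. A group $G$ acts transitively from the left on a non-empty set $M$; the action is written $(g,m)\mapsto g\triangleright m$. An element $m_0\in M$ and, for each $m\in M$, an element $g_{m_0,m}\in G$ with $g_{m_0,m}\triangleright m_0=m$ are fixed; $\mathcal{R}=((M,G,\triangleright),(m_0,(g_{m_0,m})_{m\in M}))$ is called a cell space. The stabiliser $G_0$ of $m_0$ is finite. The right semi-action of $G/G_0$ on $M$ is $m\triangleleft gG_0=g_{m_0,m}g\triangleright m_0$. Identify $M$ with $G/G_0$ via $m\mapsto\{g\in G: g\triangleright m_0=m\}$; then $m\triangleleft n=g_{m_0,m}\triangleright n$ for $m,n\in M$. For $A\subseteq M$, $A\triangleleft\mathfrak{g}=\{a\triangleleft\mathfrak{g}: a\in A\}$. $\mathcal{R}$ is finitely right generated, and $S$ is a fixed finite symmetric right generating set: a finite $S\subseteq G/G_0$ with $G_0\cdot S\subseteq S$ and $S^{-1}:=\{g^{-1}G_0: s\in S,\ g\in s\}\subseteq S$ such that each $m\in M$ has the form $(((m_0\triangleleft s_1)\triangleleft s_2)\cdots)\triangleleft s_k$ with $k\ge 0$, $s_i\in S$. $d$ is the path metric on $M$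 of the graph with an edge from $m$ to $m\triangleleft s$ for $m\in M$, $s\in S$. $\mathbb{B}(m,\rho)=\{m'\in M: d(m,m')\le\rho\}$ and $\mathbb{B}(\rho)=\mathbb{B}(m_0,\rho)$ for $\rho\in\mathbb{N}_0$. For $A,B\subseteq M$, $d(A,B)=\inf\{d(a,b): a\in A, b\in B\}$ (with $\inf\emptyset=\infty$). For $A\subseteq M$ and $\theta\in\mathbb{N}_0$: $A^{-\theta}=\{m\in A:\mathbb{B}(m,\theta)\subseteq A\}$, $A^{+\theta}=\{m\in M:\mathbb{B}(m,\theta)\cap A\neq\emptyset\}$, $\partial_\theta A=A^{+\theta}\setminus A^{-\theta}$. $H$ is a fixed subgroup of $G$ containing all $g_{m_0,m}$, $m\in M$; $H_0=H\cap G_0$. $Q$ is a finite set. Patterns and subshifts. For $A\subseteq M$, an $A$-pattern is a map $p\colon A\to Q$, with domain $\mathrm{dom}(p)=A$; it is finite if $A$ is finite. For $g\in G$, $g\blacktriangleright p\colon g\triangleright A\to Q$, $m\mapsto p(g^{-1}\triangleright m)$. An $A$-pattern $p$ semi-occurs in an $A'$-pattern $p'$ if there is $h\in H$ with $h\triangleright A\subseteq A'$ and $h\blacktriangleright p=p'|_{h\triangleright A}$. For a set $\mathfrak{F}$ of finite patterns, $\langle\mathfrak{F}\rangle$ is the set of $c\in Q^M$ in which no $\mathfrak{f}\in\mathfrak{F}$ semi-occurs. A subset $X\subseteq Q^M$ is a subshift of $Q^M$ if $X=\langle\mathfrak{F}\rangle$ for some set $\mathfrak{F}$ of finite patterns.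 A pattern is allowed in $X$ if it semi-occurs in some $x\in X$. For $X\subseteq Q^M$ and $A\subseteq M$, $X_A=\{x|_A: x\in X\}$. A subshift $X$ is $\kappa$-strongly irreducible ($\kappa\in\mathbb{N}_0$) if for all finite patterns $p,p'$ allowed in $X$ with $d(\mathrm{dom}(p),\mathrm{dom}(p'))\ge\kappa+1$ there is $x\in X$ with $x|_{\mathrm{dom}(p)}=p$ and $x|_{\mathrm{dom}(p')}=p'$; it is strongly irreducible if it is so for some $\kappa$. Local maps. For subshifts $X,Y$, a map $\Delta\colon X\to Y$ is $\kappa$-local if there are $N\subseteq\mathbb{B}(\kappa)$ with $G_0\triangleright N\subseteq N$ and $\delta\colon X_N\to Q$ with $\delta(h_0\blacktriangleright\ell)=\delta(\ell)$ for all $h_0\in H_0$, $\ell\in X_N$, such that $\Delta(x)(m)=\delta(n\mapsto x(m\triangleleft n))$ for all $x\in X$, $m\in M$; it is local if it is $\kappa$-local for some $\kappa\in\mathbb{N}_0$. Amenability and entropy. $\mathcal{R}$ is right amenable if there is a finitely additive probability measure $\mu$ on all subsets of $M$ such that $\mu(A\triangleleft\mathfrak{g})=\mu(A)$ for all $\mathfrak{g}\in G/G_0$ and all $A\subseteq M$ on which $m\mapsto m\triangleleft\mathfrak{g}$ is injective; since $G_0$ is finite, this is equivalent to the existence of a right Følner net, i.e. a net $(F_i)_{i\in I}$ of non-empty finite subsets of $M$ with $\lim_{i\in I}|\partial_\rho F_i|/|F_i|=0$ for every $\rho\in\mathbb{N}_0$. For such a net $\mathcal{F}$ and $X\subseteq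 Q^M$, the entropy is $\mathrm{ent}_{\mathcal{F}}(X)=\limsup_{i\in I}\log|X_{F_i}|/|F_i|$ (with $\log 0=-\infty$). *)

theory Defs
  imports Complex_Main "HOL-Library.Extended_Real" "HOL-Algebra.Group_Action" "HOL-Algebra.Left_Coset"
begin

section \<open>Nets\<close>

definition directed_set :: "'i set \<Rightarrow> ('i \<Rightarrow> 'i \<Rightarrow> bool) \<Rightarrow> bool" where
  "directed_set I leq \<longleftrightarrow> I \<noteq> {} \<and> (\<forall>i\<in>I. leq i i) \<and>
     (\<forall>i\<in>I. \<forall>j\<in>I. \<forall>k\<in>I. leq i j \<longrightarrow> leq j k \<longrightarrow> leq i k) \<and>
     (\<forall>i\<in>I. \<forall>j\<in>I. \<exists>k\<in>I. leq i k \<and> leq j k)"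

text \<open>The filter of the tails of a directed set; limits along a net are limits along it.\<close>

definition net_filter :: "'i set \<Rightarrow> ('i \<Rightarrow> 'i \<Rightarrow> bool) \<Rightarrow> 'i filter" where
  "net_filter I leq = (INF i\<in>I. principal {j \<in> I. leq i j})"

lemma eventually_net_filter:
  assumes "directed_set I leq"
  shows "eventually P (net_filter I leq) \<longleftrightarrow> (\<exists>i\<in>I. \<forall>j\<in>I. leq i j \<longrightarrow> P j)"
proof -
  have *: "\<exists>x\<in>I. principal {j \<in> I. leq x j}
             \<le> inf (principal {j \<in> I. leq a j}) (principal {j \<in> I. leq b j})"
    if ab: "a \<in> I" "b \<in> I" for a b
  proof -
    have "\<forall>i\<in>I. \<forall>j\<in>I. \<exists>k\<in>I. leq i k \<and> leq j k"
      using assms unfolding directed_set_def by (elim conjE)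
    then obtain k where k: "k \<in> I" "leq a k" "leq b k" using ab by blast
    have "{j \<in> I. leq k j} \<subseteq> {j \<in> I. leq a j} \<inter> {j \<in> I. leq b j}"
      using assms ab k unfolding directed_set_def by blast
    then show ?thesis using k(1) by auto
  qed
  have "I \<noteq> {}" using assms by (simp add: directed_set_def)
  then show ?thesis
    unfolding net_filter_def
    by (subst eventually_INF_base) (use * in \<open>auto simp: eventually_principal\<close>)
qed

section \<open>Cell spaces\<close>

text \<open>The left action \<open>g \<triangleright> m\<close> is \<open>\<phi> g m\<close>, and \<open>coord m\<close> is the fixed element \<open>g\<close> with
  \<open>g \<triangleright> m0 = m\<close>.\<close>

locale cell_space = transitive_action G M \<phi>
  for G (structure) and M and \<phi> +
  fixes m0 :: 'm and coord :: "'m \<Rightarrow> 'g"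
  assumes origin: "m0 \<in> M"
    and coord_carrier: "m \<in> M \<Longrightarrow> coord m \<in> carrier G"
    and coord_origin: "m \<in> M \<Longrightarrow> \<phi> (coord m) m0 = m"
begin

abbreviation G0 :: "'g set" where
  "G0 \<equiv> stabilizer G \<phi> m0"

text \<open>The right semi-action of \<open>G / G0\<close>: the image below is a singleton whenever \<open>C\<close> is a
  left coset of \<open>G0\<close>.\<close>

definition ract :: "'m \<Rightarrow> 'g set \<Rightarrow> 'm" where
  "ract m C = the_elem ((\<lambda>g. \<phi> (coord m \<otimes> g) m0) ` C)"

definition coset_of :: "'m \<Rightarrow> 'g set" where
  "coset_of m = {g \<in> carrier G. \<phi> g m0 = m}"

text \<open>The semi-action after the identification of \<open>M\<close> with \<open>G / G0\<close>.\<close>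

definition ractm :: "'m \<Rightarrow> 'm \<Rightarrow> 'm" where
  "ractm m n = ract m (coset_of n)"

definition right_amenable :: bool where
  "right_amenable \<longleftrightarrow> (\<exists>\<mu> :: 'm set \<Rightarrow> real.
     (\<forall>A. A \<subseteq> M \<longrightarrow> 0 \<le> \<mu> A) \<and> \<mu> M = 1 \<and>
     (\<forall>A B. A \<subseteq> M \<longrightarrow> B \<subseteq> M \<longrightarrow> A \<inter> B = {} \<longrightarrow> \<mu> (A \<union> B) = \<mu> A + \<mu> B) \<and>
     (\<forall>C\<in>lcosets G0. \<forall>A. A \<subseteq> M \<longrightarrow> inj_on (\<lambda>m. ract m C) A \<longrightarrow>
        \<mu> ((\<lambda>m. ract m C) ` A) = \<mu> A))"

lemma ract_l_coset:
  assumes "m \<in> M" "g \<in> carrier G"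
  shows "ract m (g <#\<^bsub>G\<^esub> G0) = \<phi> (coord m \<otimes> g) m0"
proof -
  interpret group G by (rule group_hom.axioms(1)[OF group_hom])
  have "(\<lambda>g. \<phi> (coord m \<otimes> g) m0) ` (g <#\<^bsub>G\<^esub> G0) = {\<phi> (coord m \<otimes> g) m0}"
  proof -
    have const: "\<phi> (coord m \<otimes> (g \<otimes> h)) m0 = \<phi> (coord m \<otimes> g) m0" if h: "h \<in> G0" for h
    proof -
      have hc: "h \<in> carrier G" "\<phi> h m0 = m0" using h by (auto simp: stabilizer_def)
      have c: "coord m \<in> carrier G" using assms(1) by (rule coord_carrier)
      have "coord m \<otimes> (g \<otimes> h) = (coord m \<otimes> g) \<otimes> h"
        using c assms(2) hc(1) by (simp only: m_assoc)
      moreover have "\<phi> ((coord m \<otimes> g) \<otimes> h) m0 = \<phi> (coord m \<otimes> g) (\<phi> h m0)"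
        using c assms(2) hc(1) origin by (intro composition_rule m_closed)
      ultimately show ?thesis by (simp only: hc(2))
    qed
    have "\<one> \<in> G0"
      using origin by (simp add: stabilizer_def id_eq_one[symmetric])
    then have gin: "g \<in> g <#\<^bsub>G\<^esub> G0"
      using assms(2) unfolding l_coset_def by (auto intro!: bexI[of _ "\<one>"])
    have all: "\<phi> (coord m \<otimes> k) m0 = \<phi> (coord m \<otimes> g) m0" if k: "k \<in> g <#\<^bsub>G\<^esub> G0" for k
    proof -
      obtain h where h: "h \<in> G0" "k = g \<otimes> h" using k unfolding l_coset_def by blast
      show ?thesis unfolding h(2) by (rule const[OF h(1)])
    qed
    show ?thesis
    proof
      show "(\<lambda>g. \<phi> (coord m \<otimes> g) m0) ` (g <#\<^bsub>G\<^esub> G0) \<subseteq> {\<phi> (coord m \<otimes> g) m0}"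
        by (rule image_subsetI) (simp only: all singleton_iff)
      show "{\<phi> (coord m \<otimes> g) m0} \<subseteq> (\<lambda>g. \<phi> (coord m \<otimes> g) m0) ` (g <#\<^bsub>G\<^esub> G0)"
        using imageI[OF gin, of "\<lambda>g. \<phi> (coord m \<otimes> g) m0"] by (simp only: empty_subsetI insert_subset)
    qed
  qed
  then show ?thesis by (simp add: ract_def)
qed

lemma coset_of_eq:
  assumes "n \<in> M" shows "coset_of n = coord n <#\<^bsub>G\<^esub> G0"
proof -
  interpret group G by (rule group_hom.axioms(1)[OF group_hom])
  have c: "coord n \<in> carrier G" using assms by (rule coord_carrier)
  show ?thesis
  proof
    show "coset_of n \<subseteq> coord n <#\<^bsub>G\<^esub> G0"
    proof
      fix g assume "g \<in> coset_of n"
      then have g: "g \<in> carrier G" "\<phi> g m0 = n" by (auto simp: coset_of_def)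
      have i: "\<phi> (inv (coord n)) n = m0"
        by (rule orbit_sym_aux[OF c origin coord_origin[OF assms]])
      have "\<phi> (inv (coord n) \<otimes> g) m0 = \<phi> (inv (coord n)) (\<phi> g m0)"
        using c g(1) origin by (intro composition_rule inv_closed)
      then have "inv (coord n) \<otimes> g \<in> G0"
        using g c i by (simp add: stabilizer_def)
      moreover have "g = coord n \<otimes> (inv (coord n) \<otimes> g)"
        using g(1) c by (simp add: m_assoc[symmetric])
      ultimately show "g \<in> coord n <#\<^bsub>G\<^esub> G0" unfolding l_coset_def by blast
    qed
  next
    show "coord n <#\<^bsub>G\<^esub> G0 \<subseteq> coset_of n"
    proof
      fix g assume "g \<in> coord n <#\<^bsub>G\<^esub> G0"
      then obtain h where h: "h \<in> G0" "g = coord n \<otimes> h" unfolding l_coset_def by blast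
      have hc: "h \<in> carrier G" "\<phi> h m0 = m0" using h(1) by (auto simp: stabilizer_def)
      have "\<phi> (coord n \<otimes> h) m0 = \<phi> (coord n) (\<phi> h m0)"
        by (rule composition_rule[OF origin c hc(1)])
      also have "\<dots> = n" unfolding hc(2) by (rule coord_origin[OF assms])
      finally show "g \<in> coset_of n" using c hc(1) h(2) by (simp add: coset_of_def)
    qed
  qed
qed

lemma ractm_eq:
  assumes "m \<in> M" "n \<in> M"
  shows "ractm m n = \<phi> (coord m) n"
proof -
  have "ractm m n = \<phi> (coord m \<otimes> coord n) m0"
    unfolding ractm_def coset_of_eq[OF assms(2)]
    by (rule ract_l_coset[OF assms(1) coord_carrier[OF assms(2)]])
  also have "\<dots> = \<phi> (coord m) (\<phi> (coord n) m0)"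
    by (rule composition_rule[OF origin coord_carrier[OF assms(1)] coord_carrier[OF assms(2)]])
  also have "\<dots> = \<phi> (coord m) n" unfolding coord_origin[OF assms(2)] ..
  finally show ?thesis .
qed

end

locale generated_cell_space = cell_space G M \<phi> m0 coord
  for G (structure) and M and \<phi> and m0 :: 'm and coord :: "'m \<Rightarrow> 'g" +
  fixes S :: "'g set set"
  assumes finite_stabilizer: "finite (stabilizer G \<phi> m0)"
    and gen_finite: "finite S"
    and gen_cosets: "S \<subseteq> lcosets (stabilizer G \<phi> m0)"
    and gen_invariant: "g \<in> stabilizer G \<phi> m0 \<Longrightarrow> s \<in> S \<Longrightarrow> g <#\<^bsub>G\<^esub> s \<in> S"
    and gen_symmetric: "s \<in> S \<Longrightarrow> g \<in> s \<Longrightarrow> (inv g) <#\<^bsub>G\<^esub> stabilizer G \<phi> m0 \<in> S"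
    and gen_generates: "m \<in> M \<Longrightarrow> \<exists>ss. set ss \<subseteq> S \<and> foldl ract m0 ss = m"
begin

definition edges :: "('m \<times> 'm) set" where
  "edges = {(m, ract m s) | m s. m \<in> M \<and> s \<in> S}"

text \<open>The path metric. Since \<open>S\<close> is symmetric, \<open>edges\<close> is a symmetric relation, and directed
  paths are the same as undirected ones.\<close>

definition cell_dist :: "'m \<Rightarrow> 'm \<Rightarrow> enat" where
  "cell_dist m m' = (INF k \<in> {k. (m, m') \<in> edges ^^ k}. enat k)"

definition set_dist :: "'m set \<Rightarrow> 'm set \<Rightarrow> enat" where
  "set_dist A B = (INF (a, b) \<in> A \<times> B. cell_dist a b)"

definition cell_ball :: "'m \<Rightarrow> nat \<Rightarrow> 'm set" where
  "cell_ball m \<rho> = {m' \<in> M. cell_dist m m' \<le> enat \<rho>}"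

definition inner :: "nat \<Rightarrow> 'm set \<Rightarrow> 'm set" where
  "inner \<theta> A = {m \<in> A. cell_ball m \<theta> \<subseteq> A}"

definition outer :: "nat \<Rightarrow> 'm set \<Rightarrow> 'm set" where
  "outer \<theta> A = {m \<in> M. cell_ball m \<theta> \<inter> A \<noteq> {}}"

definition cell_boundary :: "nat \<Rightarrow> 'm set \<Rightarrow> 'm set" where
  "cell_boundary \<theta> A = outer \<theta> A - inner \<theta> A"

definition right_folner_net :: "'i set \<Rightarrow> ('i \<Rightarrow> 'i \<Rightarrow> bool) \<Rightarrow> ('i \<Rightarrow> 'm set) \<Rightarrow> bool" where
  "right_folner_net I leq F \<longleftrightarrow> directed_set I leq \<and>
     (\<forall>i\<in>I. F i \<noteq> {} \<and> finite (F i) \<and> F i \<subseteq> M) \<and>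
     (\<forall>\<rho>. ((\<lambda>i. real (card (cell_boundary \<rho> (F i))) / real (card (F i))) \<longlongrightarrow> 0)
            (net_filter I leq))"

end

section \<open>Patterns, subshifts, local maps and entropy\<close>

text \<open>A pattern is a pair of its domain and a map that is extensional on this domain; a global
  configuration is an element of \<open>M \<rightarrow>\<^sub>E Q\<close>.\<close>

type_synonym ('m, 'q) pattern = "'m set \<times> ('m \<Rightarrow> 'q)"

definition restrictions :: "('m \<Rightarrow> 'q) set \<Rightarrow> 'm set \<Rightarrow> ('m \<Rightarrow> 'q) set" where
  "restrictions X A = (\<lambda>x. restrict x A) ` X"

definition log_nat :: "nat \<Rightarrow> ereal" where
  "log_nat n = (if n = 0 then - \<infinity> else ereal (ln (real n)))"

definition entropy ::
  "'i set \<Rightarrow> ('i \<Rightarrow> 'i \<Rightarrow> bool) \<Rightarrow> ('i \<Rightarrow> 'm set) \<Rightarrow> ('m \<Rightarrow> 'q) set \<Rightarrow> ereal" where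
  "entropy I leq F X = Limsup (net_filter I leq)
     (\<lambda>i. log_nat (card (restrictions X (F i))) / ereal (real (card (F i))))"

locale symbolic_cell_space = generated_cell_space G M \<phi> m0 coord S
  for G (structure) and M and \<phi> and m0 :: 'm and coord :: "'m \<Rightarrow> 'g" and S +
  fixes H :: "'g set" and Q :: "'q set"
  assumes H_subgroup: "subgroup H G"
    and coord_H: "m \<in> M \<Longrightarrow> coord m \<in> H"
    and finite_states: "finite Q"
begin

definition finite_patterns :: "('m, 'q) pattern set" where
  "finite_patterns = {(A, p). finite A \<and> A \<subseteq> M \<and> p \<in> A \<rightarrow>\<^sub>E Q}"

definition shift :: "'g \<Rightarrow> ('m, 'q) pattern \<Rightarrow> ('m, 'q) pattern" where
  "shift g P = (\<phi> g ` fst P, \<lambda>m\<in>\<phi> g ` fst P. snd P (\<phi> (inv g) m))"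

definition semi_occurs :: "('m, 'q) pattern \<Rightarrow> ('m, 'q) pattern \<Rightarrow> bool" where
  "semi_occurs P P' \<longleftrightarrow> (\<exists>h\<in>H. \<phi> h ` fst P \<subseteq> fst P' \<and>
     shift h P = (\<phi> h ` fst P, restrict (snd P') (\<phi> h ` fst P)))"

definition generated_shift :: "('m, 'q) pattern set \<Rightarrow> ('m \<Rightarrow> 'q) set" where
  "generated_shift FF = {c \<in> M \<rightarrow>\<^sub>E Q. \<forall>P\<in>FF. \<not> semi_occurs P (M, c)}"

definition subshift :: "('m \<Rightarrow> 'q) set \<Rightarrow> bool" where
  "subshift X \<longleftrightarrow> (\<exists>FF. FF \<subseteq> finite_patterns \<and> X = generated_shift FF)"

definition allowed :: "('m, 'q) pattern \<Rightarrow> ('m \<Rightarrow> 'q) set \<Rightarrow> bool" where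
  "allowed P X \<longleftrightarrow> (\<exists>x\<in>X. semi_occurs P (M, x))"

definition strongly_irreducible_at :: "nat \<Rightarrow> ('m \<Rightarrow> 'q) set \<Rightarrow> bool" where
  "strongly_irreducible_at \<kappa> X \<longleftrightarrow>
     (\<forall>P\<in>finite_patterns. \<forall>P'\<in>finite_patterns. allowed P X \<longrightarrow> allowed P' X \<longrightarrow>
        set_dist (fst P) (fst P') \<ge> enat (\<kappa> + 1) \<longrightarrow>
        (\<exists>x\<in>X. restrict x (fst P) = snd P \<and> restrict x (fst P') = snd P'))"

definition strongly_irreducible :: "('m \<Rightarrow> 'q) set \<Rightarrow> bool" where
  "strongly_irreducible X \<longleftrightarrow> (\<exists>\<kappa>. strongly_irreducible_at \<kappa> X)"

text \<open>Only the values of \<open>\<Delta>\<close> on \<open>X\<close> and of \<open>\<delta>\<close> on the restrictions of \<open>X\<close> to \<open>N\<close> matter.\<close>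

definition local_at ::
  "nat \<Rightarrow> ('m \<Rightarrow> 'q) set \<Rightarrow> ('m \<Rightarrow> 'q) set \<Rightarrow> (('m \<Rightarrow> 'q) \<Rightarrow> ('m \<Rightarrow> 'q)) \<Rightarrow> bool" where
  "local_at \<kappa> X Y \<Delta> \<longleftrightarrow> \<Delta> \<in> X \<rightarrow> Y \<and>
     (\<exists>N (\<delta> :: ('m \<Rightarrow> 'q) \<Rightarrow> 'q). N \<subseteq> cell_ball m0 \<kappa> \<and> (\<forall>g\<in>G0. \<phi> g ` N \<subseteq> N) \<and>
        \<delta> \<in> restrictions X N \<rightarrow> Q \<and>
        (\<forall>h\<in>H \<inter> G0. \<forall>l\<in>restrictions X N. \<delta> (snd (shift h (N, l))) = \<delta> l) \<and>
        (\<forall>x\<in>X. \<forall>m\<in>M. \<Delta> x m = \<delta> (\<lambda>n\<in>N. x (ractm m n))))"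

definition local_map ::
  "('m \<Rightarrow> 'q) set \<Rightarrow> ('m \<Rightarrow> 'q) set \<Rightarrow> (('m \<Rightarrow> 'q) \<Rightarrow> ('m \<Rightarrow> 'q)) \<Rightarrow> bool" where
  "local_map X Y \<Delta> \<longleftrightarrow> (\<exists>\<kappa>. local_at \<kappa> X Y \<Delta>)"

end

end

theory Submission
  imports Defs
begin

text \<open>
  By compactness \<open>\<Delta> ` X\<close> is closed, and it is invariant under \<open>H\<close>. Hence a point of \<open>Y\<close> outside it
  provides, for some radius \<open>r\<close> and every cell \<open>t\<close>, a pattern on the \<open>r\<close>-ball about \<open>t\<close> that occurs in \<open>Y\<close>
  but in no point of \<open>\<Delta> ` X\<close>. If \<open>Y\<close> is \<open>\<kappa>\<close>-strongly irreducible, every pattern of \<open>Y\<close> on a finite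
  set \<open>A\<close> can be changed on the ball of radius \<open>R = r + \<kappa>\<close> about \<open>t\<close> alone so as to show the
  forbidden pattern at \<open>t\<close>. As this change is at most \<open>K\<close>-to-one, with \<open>K\<close> independent of \<open>t\<close>,
  forbidding the pattern at \<open>n\<close> cells whose \<open>R\<close>-balls are disjoint and lie in \<open>A\<close> costs a factor
  \<open>(K / (K + 1)) ^ n\<close>. A maximal such packing of \<open>F i\<close> has at least a fixed positive proportion of
  \<open>card (F i)\<close> cells once the boundary of \<open>F i\<close> is small, so the entropy drops.
\<close>

section \<open>Geometry of cell spaces\<close>

context cell_space
begin

lemma group_G: "group G"
  by (rule group_hom.axioms(1)[OF group_hom])

lemma act_closed: "g \<in> carrier G \<Longrightarrow> m \<in> M \<Longrightarrow> \<phi> g m \<in> M"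
  using element_image by blast

lemma act_inv_left: "g \<in> carrier G \<Longrightarrow> m \<in> M \<Longrightarrow> \<phi> (inv g) (\<phi> g m) = m"
  using orbit_sym_aux by blast

lemma act_inv_right: "g \<in> carrier G \<Longrightarrow> m \<in> M \<Longrightarrow> \<phi> g (\<phi> (inv g) m) = m"
  using act_inv_left[of "inv g" m] group_G by (simp add: group.inv_closed group.inv_inv)

lemma act_one: "m \<in> M \<Longrightarrow> \<phi> \<one> m = m"
  using id_eq_one by (metis restrict_apply')

end

context generated_cell_space
begin

section \<open>The graph of the generators and its symmetries\<close>

lemma edgesE:
  assumes "(m, m') \<in> edges"
  obtains c where "m \<in> M" "c \<in> carrier G" "c <#\<^bsub>G\<^esub> G0 \<in> S" "m' = \<phi> (coord m \<otimes> c) m0"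
proof -
  obtain s where s: "m \<in> M" "s \<in> S" "m' = ract m s"
    using assms unfolding edges_def by blast
  then obtain c where "c \<in> carrier G" "s = c <#\<^bsub>G\<^esub> G0"
    using gen_cosets unfolding LCOSETS_def by blast
  then show thesis using s ract_l_coset that by blast
qed

text \<open>Edges are defined through the chosen \<open>coord m\<close>, but any \<open>g\<close>
  carrying \<open>m0\<close> to \<open>m\<close> describes them equally well: \<open>g\<close> is
  \<open>coord m\<close> times some \<open>k\<close> in \<open>G0\<close>, and left multiplication
  by \<open>k\<close> maps \<open>S\<close> into itself.\<close>

lemma edgesI:
  assumes g: "g \<in> carrier G" and c: "c \<in> carrier G" and S: "c <#\<^bsub>G\<^esub> G0 \<in> S"
  shows "(\<phi> g m0, \<phi> (g \<otimes> c) m0) \<in> edges"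
proof -
  interpret group G by (rule group_G)
  define m where "m = \<phi> g m0"
  define k where "k = inv (coord m) \<otimes> g"
  have m: "m \<in> M" unfolding m_def by (rule act_closed[OF g origin])
  note cm = coord_carrier[OF m]
  have k: "k \<in> carrier G" using g cm by (simp add: k_def)
  have "\<phi> k m0 = \<phi> (inv (coord m)) m"
    unfolding k_def m_def[symmetric] using composition_rule[OF origin inv_closed[OF cm] g]
    by (simp add: m_def)
  also have "\<dots> = m0" using act_inv_left[OF cm origin] coord_origin[OF m] by simp
  finally have "k \<in> G0" using k by (simp add: stabilizer_def)
  then have "k <#\<^bsub>G\<^esub> (c <#\<^bsub>G\<^esub> G0) \<in> S" using S gen_invariant by blast
  then have "(k \<otimes> c) <#\<^bsub>G\<^esub> G0 \<in> S"
    using lcos_m_assoc[OF stabilizer_subset k c] by simp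
  moreover have "ract m ((k \<otimes> c) <#\<^bsub>G\<^esub> G0) = \<phi> (g \<otimes> c) m0"
  proof -
    have "coord m \<otimes> (k \<otimes> c) = g \<otimes> c"
      using g c cm by (simp add: k_def m_assoc[symmetric])
    then show ?thesis using ract_l_coset[OF m m_closed[OF k c]] by simp
  qed
  ultimately show ?thesis
    unfolding m_def[symmetric] edges_def using m by force
qed

text \<open>\<open>g \<otimes> coord m\<close> carries \<open>m0\<close> to
  \<open>\<phi> g m\<close>, so the free choice of representative in \<open>edgesI\<close> makes
  left translation a symmetry of the graph, although the semi-action need not commute with
  \<open>\<phi> g\<close>.\<close>

lemma edges_translate:
  assumes "(m, m') \<in> edges" "g \<in> carrier G"
  shows "(\<phi> g m, \<phi> g m') \<in> edges"
proof -
  interpret group G by (rule group_G)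
  obtain c where c: "m \<in> M" "c \<in> carrier G" "c <#\<^bsub>G\<^esub> G0 \<in> S" "m' = \<phi> (coord m \<otimes> c) m0"
    using assms(1) by (rule edgesE)
  note cm = coord_carrier[OF c(1)]
  have "\<phi> (g \<otimes> coord m) m0 = \<phi> g m"
    using composition_rule[OF origin assms(2) cm] coord_origin[OF c(1)] by simp
  moreover have "\<phi> (g \<otimes> coord m \<otimes> c) m0 = \<phi> g m'"
    using composition_rule[OF origin assms(2) m_closed[OF cm c(2)]] c(4) assms(2) cm c(2)
    by (simp add: m_assoc)
  ultimately show ?thesis using edgesI[OF m_closed[OF assms(2) cm] c(2,3)] by simp
qed

text \<open>An edge given by \<open>c\<close>, read backwards, is given by \<open>inv c\<close>,
  whose coset lies in \<open>S\<close> because \<open>S\<close> is symmetric.\<close>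

lemma edges_sym:
  assumes "(m, m') \<in> edges"
  shows "(m', m) \<in> edges"
proof -
  interpret group G by (rule group_G)
  obtain c where c: "m \<in> M" "c \<in> carrier G" "c <#\<^bsub>G\<^esub> G0 \<in> S" "m' = \<phi> (coord m \<otimes> c) m0"
    using assms(1) by (rule edgesE)
  note cm = coord_carrier[OF c(1)]
  have "c \<in> c <#\<^bsub>G\<^esub> G0"
    using stabilizer_one_closed[OF origin] c(2) unfolding l_coset_def by force
  then have "inv c <#\<^bsub>G\<^esub> G0 \<in> S" using gen_symmetric c(3) by blast
  then have "(\<phi> (coord m \<otimes> c) m0, \<phi> (coord m \<otimes> c \<otimes> inv c) m0) \<in> edges"
    using cm c(2) by (intro edgesI) auto
  then show ?thesis using c cm by (simp add: m_assoc coord_origin)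
qed

lemma edges_closed: "(m, m') \<in> edges \<Longrightarrow> m \<in> M \<and> m' \<in> M"
  using edges_sym by (blast elim: edgesE)

lemma path_closed: "(m, m') \<in> edges ^^ k \<Longrightarrow> m \<in> M \<Longrightarrow> m' \<in> M"
  by (induction k arbitrary: m') (auto dest: edges_closed)

lemma path_sym: "(m, m') \<in> edges ^^ k \<Longrightarrow> (m', m) \<in> edges ^^ k"
proof (induction k arbitrary: m')
  case (Suc k)
  then obtain l where "(m, l) \<in> edges ^^ k" "(l, m') \<in> edges" by auto
  then show ?case using Suc.IH edges_sym relpow_Suc_I2 by metis
qed auto

lemma path_translate:
  "(m, m') \<in> edges ^^ k \<Longrightarrow> g \<in> carrier G \<Longrightarrow> (\<phi> g m, \<phi> g m') \<in> edges ^^ k"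
  by (induction k arbitrary: m') (auto intro: edges_translate)

section \<open>The path metric and its balls\<close>

text \<open>An infimum in \<open>enat\<close> below a finite bound is attained; the detour over
  \<open>Suc r\<close> supplies the strict inequality that yields a witness. Without a path the
  infimum is infinite and both sides fail.\<close>

lemma cell_dist_le_iff: "cell_dist m m' \<le> enat r \<longleftrightarrow> (\<exists>k\<le>r. (m, m') \<in> edges ^^ k)"
proof
  let ?K = "{k. (m, m') \<in> edges ^^ k}"
  assume le: "cell_dist m m' \<le> enat r"
  have "cell_dist m m' < enat (Suc r)"
    using le by (rule order_le_less_trans) simp
  then obtain k where "k \<in> ?K" "enat k < enat (Suc r)"
    unfolding cell_dist_def INF_less_iff by blast
  then show "\<exists>k\<le>r. (m, m') \<in> edges ^^ k" by (auto simp: less_Suc_eq_le)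
next
  assume "\<exists>k\<le>r. (m, m') \<in> edges ^^ k"
  then obtain k where k: "k \<le> r" "(m, m') \<in> edges ^^ k" by blast
  then have "cell_dist m m' \<le> enat k"
    unfolding cell_dist_def by (intro INF_lower) simp
  then show "cell_dist m m' \<le> enat r" using k(1) by (simp add: order_trans)
qed

lemma mem_cell_ball_iff:
  "m \<in> M \<Longrightarrow> m' \<in> cell_ball m r \<longleftrightarrow> (\<exists>k\<le>r. (m, m') \<in> edges ^^ k)"
  unfolding cell_ball_def cell_dist_le_iff using path_closed by blast

lemma cell_ball_subset: "cell_ball m r \<subseteq> M"
  by (auto simp: cell_ball_def)

lemma cell_ball_center: "m \<in> M \<Longrightarrow> m \<in> cell_ball m r"
  by (auto simp: mem_cell_ball_iff intro!: exI[of _ 0])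

lemma cell_ball_mono: "r \<le> r' \<Longrightarrow> cell_ball m r \<subseteq> cell_ball m r'"
  unfolding cell_ball_def by (auto intro: order_trans)

lemma cell_ball_sym:
  assumes "m \<in> M" "m' \<in> cell_ball m r"
  shows "m \<in> cell_ball m' r"
proof -
  have "m' \<in> M" using assms(2) cell_ball_subset by blast
  then show ?thesis using assms mem_cell_ball_iff path_sym by blast
qed

lemma cell_ball_trans:
  assumes "m \<in> M" "m' \<in> cell_ball m r" "m'' \<in> cell_ball m' r'"
  shows "m'' \<in> cell_ball m (r + r')"
proof -
  have "m' \<in> M" using assms(2) cell_ball_subset by blast
  then obtain k k' where k: "k \<le> r" "(m, m') \<in> edges ^^ k" "k' \<le> r'" "(m', m'') \<in> edges ^^ k'"
    using assms mem_cell_ball_iff by metis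
  then have "(m, m'') \<in> edges ^^ (k + k')" by (auto simp: relpow_add)
  then show ?thesis using k assms(1) mem_cell_ball_iff add_mono by metis
qed

lemma act_cell_ball:
  assumes "g \<in> carrier G" "m \<in> M"
  shows "\<phi> g ` cell_ball m r \<subseteq> cell_ball (\<phi> g m) r"
  using path_translate[OF _ assms(1)] mem_cell_ball_iff[OF assms(2)]
    mem_cell_ball_iff[OF act_closed[OF assms]] by blast

text \<open>Every path has at most \<open>card S\<close> continuations, wherever it ends. That the
  bound does not mention \<open>m\<close> makes the later constants uniform over
  \<open>M\<close>.\<close>

lemma path_card:
  assumes "m \<in> M"
  shows "finite {m'. (m, m') \<in> edges ^^ k} \<and> card {m'. (m, m') \<in> edges ^^ k} \<le> card S ^ k"
proof (induction k)
  case (Suc k)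
  let ?P = "\<lambda>k. {m'. (m, m') \<in> edges ^^ k}"
  have sub: "?P (Suc k) \<subseteq> (\<lambda>(l, s). ract l s) ` (?P k \<times> S)"
    by (force simp: edges_def)
  have fin: "finite (?P k \<times> S)" using Suc gen_finite by auto
  have "card (?P (Suc k)) \<le> card (?P k \<times> S)"
    using card_mono[OF finite_imageI[OF fin] sub] card_image_le[OF fin] le_trans by blast
  also have "\<dots> \<le> card S ^ Suc k" using Suc by (simp add: card_cartesian_product mult.commute)
  finally show ?case using finite_subset[OF sub finite_imageI[OF fin]] by blast
qed auto

lemma cell_ball_eq_UN: "m \<in> M \<Longrightarrow> cell_ball m r = (\<Union>k\<le>r. {m'. (m, m') \<in> edges ^^ k})"
  by (auto simp: mem_cell_ball_iff)

lemma finite_cell_ball: "m \<in> M \<Longrightarrow> finite (cell_ball m r)"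
  using path_card by (simp add: cell_ball_eq_UN)

lemma card_cell_ball_le:
  assumes "m \<in> M"
  shows "card (cell_ball m r) \<le> (\<Sum>k\<le>r. card S ^ k)"
proof -
  have "card (cell_ball m r) \<le> (\<Sum>k\<le>r. card {m'. (m, m') \<in> edges ^^ k})"
    unfolding cell_ball_eq_UN[OF assms] by (rule card_UN_le) simp
  also have "\<dots> \<le> (\<Sum>k\<le>r. card S ^ k)" using path_card[OF assms] by (intro sum_mono) auto
  finally show ?thesis .
qed

lemma foldl_ract_path:
  "set ss \<subseteq> S \<Longrightarrow> m \<in> M \<Longrightarrow> (m, foldl ract m ss) \<in> edges ^^ length ss"
proof (induction ss arbitrary: m)
  case (Cons s ss)
  have e: "(m, ract m s) \<in> edges" using Cons.prems unfolding edges_def by auto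
  then have "(ract m s, foldl ract (ract m s) ss) \<in> edges ^^ length ss"
    using Cons edges_closed by auto
  then show ?case using relpow_Suc_I2[OF e] by simp
qed auto

lemma cell_ball_exhaust: "m \<in> M \<Longrightarrow> \<exists>r. m \<in> cell_ball m0 r"
  using gen_generates foldl_ract_path origin by (metis mem_cell_ball_iff order_refl)

lemma finite_subset_cell_ball:
  assumes "finite A" "A \<subseteq> M"
  shows "\<exists>r. A \<subseteq> cell_ball m0 r"
  using assms
proof (induction A)
  case (insert a A)
  then obtain r where "A \<subseteq> cell_ball m0 r" by auto
  moreover obtain r' where "a \<in> cell_ball m0 r'" using insert.prems cell_ball_exhaust by auto
  ultimately have "insert a A \<subseteq> cell_ball m0 (max r r')"
    using cell_ball_mono[of r "max r r'"] cell_ball_mono[of r' "max r r'"]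
    by (meson insert_subset max.cobounded1 max.cobounded2 subset_iff)
  then show ?case by blast
qed auto

section \<open>Packings, boundaries and separated sets\<close>

text \<open>\<open>T\<close> is a packing by \<open>R\<close>-balls that is maximal under inclusion.
  By maximality the balls of doubled radius about \<open>T\<close> cover \<open>inner R A\<close>,
  and each of them has at most the stated number of cells.\<close>

lemma inner_card_le_packing:
  assumes F: "finite A" "A \<subseteq> M"
  obtains T where "T \<subseteq> inner R A" "finite T"
    "\<And>s t. s \<in> T \<Longrightarrow> t \<in> T \<Longrightarrow> s \<noteq> t \<Longrightarrow> cell_ball s R \<inter> cell_ball t R = {}"
    "card (inner R A) \<le> card T * (\<Sum>k\<le>R + R. card S ^ k)"
proof -
  let ?D = "\<lambda>T. \<forall>s\<in>T. \<forall>t\<in>T. s \<noteq> t \<longrightarrow> cell_ball s R \<inter> cell_ball t R = {}"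
  have inner: "inner R A \<subseteq> A" by (auto simp: inner_def)
  define \<T> where "\<T> = {T. T \<subseteq> inner R A \<and> ?D T}"
  have "\<T> \<subseteq> Pow A" using inner by (auto simp: \<T>_def)
  then have fin: "finite \<T>" using F(1) by (simp add: finite_subset)
  have ne: "{} \<in> \<T>" by (simp add: \<T>_def)
  from finite_has_maximal2[OF fin ne]
  obtain T where T\<T>: "T \<in> \<T>" and max: "\<forall>T'\<in>\<T>. T \<subseteq> T' \<longrightarrow> T = T'"
    by (elim bexE conjE) (rule that)
  have T: "T \<subseteq> inner R A" "?D T" using T\<T> by (simp_all add: \<T>_def)
  have fT: "finite T" by (rule finite_subset[OF subset_trans[OF T(1) inner] F(1)])
  have TM: "T \<subseteq> M" using T(1) inner F(2) by blast
  have "inner R A \<subseteq> (\<Union>t\<in>T. cell_ball t (R + R))"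
  proof
    fix m assume m: "m \<in> inner R A"
    then have mM: "m \<in> M" using inner F by blast
    have "\<exists>t\<in>T. cell_ball m R \<inter> cell_ball t R \<noteq> {}"
    proof (rule ccontr)
      assume none: "\<not> ?thesis"
      then have "?D (insert m T)" using T(2) by (auto simp: Int_commute)
      then have "insert m T \<in> \<T>" using T(1) m by (simp add: \<T>_def)
      then have "T = insert m T" using max by blast
      then have "m \<in> T" by blast
      then show False using none cell_ball_center[OF mM] by blast
    qed
    \<comment> \<open>A common cell \<open>l\<close> of the two \<open>R\<close>-balls puts
      \<open>m\<close> within \<open>R + R\<close> of \<open>t\<close>.\<close>
    then obtain t l where t: "t \<in> T" "l \<in> cell_ball m R" "l \<in> cell_ball t R" by blast
    then have "m \<in> cell_ball t (R + R)"
      using cell_ball_trans cell_ball_sym[OF mM] TM by blast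
    then show "m \<in> (\<Union>t\<in>T. cell_ball t (R + R))" using t by blast
  qed
  moreover have "finite (\<Union>t\<in>T. cell_ball t (R + R))" using fT TM finite_cell_ball by blast
  ultimately have "card (inner R A) \<le> card (\<Union>t\<in>T. cell_ball t (R + R))" by (rule card_mono[rotated])
  also have "\<dots> \<le> (\<Sum>t\<in>T. card (cell_ball t (R + R)))" by (rule card_UN_le[OF fT])
  also have "\<dots> \<le> card T * (\<Sum>k\<le>R + R. card S ^ k)"
    using sum_bounded_above[of T "\<lambda>t. card (cell_ball t (R + R))"] card_cell_ball_le TM by auto
  finally show thesis using that[OF T(1) fT] T(2) by blast
qed

text \<open>Every cell of \<open>A\<close> lies in \<open>outer R A\<close>, hence in the boundary
  unless it is inner. The cover of the outer set by balls about \<open>A\<close> gives finiteness;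
  \<open>card\<close> of an infinite boundary would be 0.\<close>

lemma card_le_inner_plus_boundary:
  assumes "finite A" "A \<subseteq> M"
  shows "card A \<le> card (inner R A) + card (cell_boundary R A)"
proof -
  have "outer R A \<subseteq> (\<Union>a\<in>A. cell_ball a R)"
    using cell_ball_sym by (auto simp: outer_def)
  then have "finite (cell_boundary R A)"
    using assms finite_cell_ball finite_subset[of _ "\<Union>a\<in>A. cell_ball a R"]
    unfolding cell_boundary_def by blast
  moreover have "finite (inner R A)" using assms by (simp add: inner_def)
  moreover have "A \<subseteq> inner R A \<union> cell_boundary R A"
    using cell_ball_center assms(2) by (auto simp: cell_boundary_def outer_def)
  ultimately show ?thesis
    by (meson card_Un_le card_mono finite_UnI le_trans)
qed

text \<open>Triangle inequality: a point within \<open>k\<close> of the \<open>r\<close>-ball would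
  lie in the ball of radius \<open>r + k\<close>. For empty \<open>A\<close> or \<open>B\<close> the
  infimum is infinite.\<close>

lemma enat_le_set_dist:
  assumes "m \<in> M" "A \<subseteq> cell_ball m r" "B \<inter> cell_ball m (r + k) = {}" "B \<subseteq> M"
  shows "enat (k + 1) \<le> set_dist A B"
  unfolding set_dist_def
proof (rule INF_greatest, clarify)
  fix a b assume ab: "a \<in> A" "b \<in> B"
  have "\<not> cell_dist a b \<le> enat k"
  proof
    assume "cell_dist a b \<le> enat k"
    then have "b \<in> cell_ball a k" using ab assms(4) by (auto simp: cell_ball_def)
    then have "b \<in> cell_ball m (r + k)" using cell_ball_trans assms(1,2) ab(1) by blast
    then show False using ab assms(3) by blast
  qed
  then show "enat (k + 1) \<le> cell_dist a b" 
    by (metis Suc_eq_plus1 eSuc_enat ileI1 not_le)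
qed

end

section \<open>Subshifts and local maps\<close>

lemma restrict_eq_iff: "restrict f A = restrict g A \<longleftrightarrow> (\<forall>a\<in>A. f a = g a)"
  unfolding restrict_def fun_eq_iff by metis

context symbolic_cell_space
begin

lemma H_carrier: "h \<in> H \<Longrightarrow> h \<in> carrier G"
  using subgroup.subset[OF H_subgroup] by blast

text \<open>For a group element \<open>g\<close> this is the second component of
  \<open>shift g (M, c)\<close>; the domain stays \<open>M\<close> because group elements permute
  the cells.\<close>

definition translate :: "'g \<Rightarrow> ('m \<Rightarrow> 'q) \<Rightarrow> ('m \<Rightarrow> 'q)" where
  "translate g c = (\<lambda>m\<in>M. c (\<phi> (inv g) m))"

text \<open>The inverse inside \<open>shift\<close> cancels against \<open>\<phi> h\<close>, so an
  occurrence can be tested cell by cell on the domain of the smaller pattern.\<close>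

lemma semi_occurs_iff:
  assumes "A \<subseteq> M"
  shows "semi_occurs (A, p) (A', c) \<longleftrightarrow> (\<exists>h\<in>H. \<phi> h ` A \<subseteq> A' \<and> (\<forall>a\<in>A. c (\<phi> h a) = p a))"
proof -
  have "shift h (A, p) = (\<phi> h ` A, restrict c (\<phi> h ` A)) \<longleftrightarrow> (\<forall>a\<in>A. c (\<phi> h a) = p a)"
    if "h \<in> H" for h
  proof -
    have "\<phi> (inv h) (\<phi> h a) = a" if "a \<in> A" for a
      using act_inv_left H_carrier \<open>h \<in> H\<close> that assms by blast
    then show ?thesis by (auto simp: shift_def restrict_eq_iff)
  qed
  then show ?thesis unfolding semi_occurs_def fst_conv snd_conv by blast
qed

lemma subshift_config: "subshift X \<Longrightarrow> x \<in> X \<Longrightarrow> x \<in> M \<rightarrow>\<^sub>E Q"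
  by (auto simp: subshift_def generated_shift_def)

text \<open>An occurrence at \<open>k\<close> of a forbidden pattern in the translate by
  \<open>h\<close> is an occurrence at \<open>inv h \<otimes> k\<close> in \<open>x\<close>, and
  this element is again in \<open>H\<close>.\<close>

lemma translate_subshift:
  assumes X: "subshift X" and x: "x \<in> X" and h: "h \<in> H"
  shows "translate h x \<in> X"
proof -
  interpret group G by (rule group_G)
  note hG = H_carrier[OF h]
  obtain FF where FF: "FF \<subseteq> finite_patterns" "X = generated_shift FF"
    using X unfolding subshift_def by blast
  have "\<not> semi_occurs P (M, translate h x)" if P: "P \<in> FF" for P
  proof
    obtain A p where Ap: "P = (A, p)" by fastforce
    have A: "A \<subseteq> M" using FF(1) P Ap by (auto simp: finite_patterns_def)
    assume "semi_occurs P (M, translate h x)"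
    then obtain k where k: "k \<in> H" "\<phi> k ` A \<subseteq> M" "\<And>a. a \<in> A \<Longrightarrow> translate h x (\<phi> k a) = p a"
      unfolding Ap semi_occurs_iff[OF A] by blast
    have kG: "k \<in> carrier G" by (rule H_carrier[OF k(1)])
    have "inv h \<otimes> k \<in> H"
      using h k(1) H_subgroup by (simp add: subgroup.m_closed subgroup.m_inv_closed)
    moreover have "\<phi> (inv h \<otimes> k) ` A \<subseteq> M" using act_closed A hG kG by auto
    moreover have "x (\<phi> (inv h \<otimes> k) a) = p a" if "a \<in> A" for a
    proof -
      have aM: "a \<in> M" using that A by blast
      have "\<phi> (inv h \<otimes> k) a = \<phi> (inv h) (\<phi> k a)"
        by (rule composition_rule[OF aM inv_closed[OF hG] kG])
      then show ?thesis using k(3)[OF that] act_closed[OF kG aM] by (simp add: translate_def)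
    qed
    ultimately have "semi_occurs P (M, x)" unfolding Ap semi_occurs_iff[OF A] by blast
    then show False using x P FF(2) by (simp add: generated_shift_def)
  qed
  moreover have "translate h x \<in> M \<rightarrow>\<^sub>E Q"
    using subshift_config[OF X x] act_closed hG by (auto simp: translate_def)
  ultimately show ?thesis using FF(2) by (simp add: generated_shift_def)
qed

text \<open>Closedness in the prodiscrete topology: forbidden patterns have finite domains, so an
  occurrence in \<open>x\<close> also shows in any approximant agreeing with \<open>x\<close> on the
  translated domain.\<close>

lemma subshift_closed:
  assumes X: "subshift X" and x: "x \<in> M \<rightarrow>\<^sub>E Q"
    and approx: "\<And>A. finite A \<Longrightarrow> A \<subseteq> M \<Longrightarrow> \<exists>x'\<in>X. \<forall>a\<in>A. x' a = x a"
  shows "x \<in> X"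
proof -
  obtain FF where FF: "FF \<subseteq> finite_patterns" "X = generated_shift FF"
    using X unfolding subshift_def by blast
  have "\<not> semi_occurs P (M, x)" if P: "P \<in> FF" for P
  proof
    obtain A p where Ap: "P = (A, p)" by fastforce
    have A: "A \<subseteq> M" "finite A" using FF(1) P Ap by (auto simp: finite_patterns_def)
    assume "semi_occurs P (M, x)"
    then obtain k where k: "k \<in> H" "\<phi> k ` A \<subseteq> M" "\<And>a. a \<in> A \<Longrightarrow> x (\<phi> k a) = p a"
      unfolding Ap semi_occurs_iff[OF A(1)] by blast
    obtain x' where x': "x' \<in> X" "\<forall>a\<in>\<phi> k ` A. x' a = x a"
      using approx[OF finite_imageI[OF A(2)] k(2)] by blast
    have "\<forall>a\<in>A. x' (\<phi> k a) = p a" using k(3) x'(2) by simp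
    then have "semi_occurs P (M, x')" unfolding Ap semi_occurs_iff[OF A(1)] using k by blast
    then show False using x'(1) P FF(2) by (simp add: generated_shift_def)
  qed
  then show ?thesis using FF(2) x by (simp add: generated_shift_def)
qed

section \<open>Continuity and equivariance of local maps\<close>

lemma local_atE:
  assumes "local_at \<kappa> X Y \<Delta>"
  obtains N and \<delta> :: "('m \<Rightarrow> 'q) \<Rightarrow> 'q" where "N \<subseteq> cell_ball m0 \<kappa>" "\<forall>g\<in>G0. \<phi> g ` N \<subseteq> N"
    "\<forall>h\<in>H \<inter> G0. \<forall>l\<in>restrictions X N. \<delta> (snd (shift h (N, l))) = \<delta> l"
    "\<forall>x\<in>X. \<forall>m\<in>M. \<Delta> x m = \<delta> (\<lambda>n\<in>N. x (ractm m n))"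
  using assms unfolding local_at_def by (elim conjE exE) (rule that)

text \<open>This is continuity at the cell \<open>m\<close>: the value depends only on the
  translated neighbourhood, which is finite because \<open>N\<close> lies in a ball.\<close>

lemma local_map_finite_dependence:
  assumes "local_at \<kappa> X Y \<Delta>" "m \<in> M"
  obtains A where "finite A" "A \<subseteq> M"
    "\<And>x x'. x \<in> X \<Longrightarrow> x' \<in> X \<Longrightarrow> (\<And>a. a \<in> A \<Longrightarrow> x a = x' a) \<Longrightarrow> \<Delta> x m = \<Delta> x' m"
proof -
  obtain N and \<delta> :: "('m \<Rightarrow> 'q) \<Rightarrow> 'q" where N: "N \<subseteq> cell_ball m0 \<kappa>"
    and D: "\<forall>x\<in>X. \<forall>m\<in>M. \<Delta> x m = \<delta> (\<lambda>n\<in>N. x (ractm m n))"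
    using assms(1) by (rule local_atE)
  have "finite N" by (rule finite_subset[OF N finite_cell_ball[OF origin]])
  moreover have "ractm m ` N \<subseteq> M"
    using N cell_ball_subset[of m0 \<kappa>] ractm_eq[OF assms(2)] act_closed coord_carrier[OF assms(2)]
    by auto
  moreover have "\<Delta> x m = \<Delta> x' m"
    if "x \<in> X" "x' \<in> X" "\<And>a. a \<in> ractm m ` N \<Longrightarrow> x a = x' a" for x x'
  proof -
    have "(\<lambda>n\<in>N. x (ractm m n)) = (\<lambda>n\<in>N. x' (ractm m n))"
      using that(3) by (auto intro: restrict_ext)
    then show ?thesis using D that(1,2) assms(2) by simp
  qed
  ultimately show thesis using that[of "ractm m ` N"] by blast
qed

text \<open>The neighbourhoods of \<open>m\<close> and of \<open>m' = \<phi> (inv h) m\<close> are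
  read through \<open>coord m\<close> and \<open>coord m'\<close>. After translation by
  \<open>h\<close> these readings differ by an element of \<open>H \<inter> G0\<close>, under which
  the local rule is invariant.\<close>

lemma local_map_equivariant:
  assumes loc: "local_at \<kappa> X Y \<Delta>" and X: "subshift X" and x: "x \<in> X" and h: "h \<in> H"
    and m: "m \<in> M"
  shows "\<Delta> (translate h x) m = \<Delta> x (\<phi> (inv h) m)"
proof -
  interpret group G by (rule group_G)
  obtain N and \<delta> :: "('m \<Rightarrow> 'q) \<Rightarrow> 'q" where N: "N \<subseteq> cell_ball m0 \<kappa>"
    and G0N: "\<forall>g\<in>G0. \<phi> g ` N \<subseteq> N"
    and inv_\<delta>: "\<forall>h\<in>H \<inter> G0. \<forall>l\<in>restrictions X N. \<delta> (snd (shift h (N, l))) = \<delta> l"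
    and D: "\<forall>x\<in>X. \<forall>m\<in>M. \<Delta> x m = \<delta> (\<lambda>n\<in>N. x (ractm m n))"
    using loc by (rule local_atE)
  have inv_N: "\<phi> g n \<in> N" if "g \<in> G0" "n \<in> N" for g n using G0N that by blast
  have NM: "n \<in> M" if "n \<in> N" for n using N that cell_ball_subset by blast
  note hG = H_carrier[OF h]
  define m' where "m' = \<phi> (inv h) m"
  have m': "m' \<in> M" unfolding m'_def using act_closed hG m by simp
  note c = coord_carrier[OF m] coord_carrier[OF m']
  \<comment> \<open>The discrepancy between \<open>h \<otimes> coord m'\<close> and
    \<open>coord m\<close>: both carry \<open>m0\<close> to \<open>m\<close>, so \<open>k\<close>
    fixes \<open>m0\<close>, and \<open>k\<close> is in \<open>H\<close> because all coordinates
    are.\<close>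
  define k where "k = inv (coord m) \<otimes> (h \<otimes> coord m')"
  have kG: "k \<in> carrier G" unfolding k_def using c hG by simp
  have kH: "k \<in> H" unfolding k_def
    using h coord_H[OF m] coord_H[OF m'] H_subgroup
    by (simp add: subgroup.m_closed subgroup.m_inv_closed)
  have "\<phi> k m0 = \<phi> (inv (coord m)) (\<phi> h (\<phi> (coord m') m0))"
    unfolding k_def using c hG origin by (simp add: composition_rule)
  also have "\<dots> = m0"
    using coord_origin[OF m'] act_inv_right[OF hG m] act_inv_left[OF c(1) origin] coord_origin[OF m]
    by (simp add: m'_def)
  finally have k0: "k \<in> G0" using kG by (simp add: stabilizer_def)
  have ik0: "inv k \<in> G0" by (rule stabilizer_m_inv_closed[OF origin k0])
  have eq: "inv h \<otimes> coord m = coord m' \<otimes> inv k"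
    using c hG by (simp add: k_def inv_mult_group m_assoc[symmetric])
  have ractm: "\<phi> (inv h) (ractm m n) = ractm m' (\<phi> (inv k) n)" if n: "n \<in> M" for n
  proof -
    have "\<phi> (inv h) (ractm m n) = \<phi> (inv h \<otimes> coord m) n"
      using n m c hG by (simp add: ractm_eq composition_rule)
    also have "\<dots> = ractm m' (\<phi> (inv k) n)"
      unfolding eq using n m' c kG act_closed[OF inv_closed[OF kG] n]
      by (simp add: ractm_eq composition_rule)
    finally show ?thesis .
  qed
  \<comment> \<open>The domain of \<open>shift k (N, l)\<close> is the image of \<open>N\<close>
    under \<open>k\<close>; it has to be \<open>N\<close> itself for the two local patterns to be
    equal as extensional functions.\<close>
  have kN: "\<phi> k ` N = N"
  proof
    show "N \<subseteq> \<phi> k ` N"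
      using inv_N[OF ik0] act_inv_right[OF kG NM] by (metis image_eqI subsetI)
    show "\<phi> k ` N \<subseteq> N" using G0N k0 by blast
  qed
  define l where "l = (\<lambda>n\<in>N. x (ractm m' n))"
  \<comment> \<open>Invariance of \<open>\<delta>\<close> is available only for patterns of
    \<open>X\<close>; \<open>l\<close> is one since it is read off a translate of \<open>x\<close>
    by an element of \<open>H\<close>.\<close>
  have "l = restrict (translate (inv (coord m')) x) N"
    unfolding l_def using c m' NM
    by (intro restrict_ext) (simp add: translate_def ractm_eq)
  then have l: "l \<in> restrictions X N"
    using translate_subshift[OF X x subgroup.m_inv_closed[OF H_subgroup coord_H[OF m']]]
    by (auto simp: restrictions_def)
  have "\<Delta> (translate h x) m = \<delta> (\<lambda>n\<in>N. translate h x (ractm m n))"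
    using D translate_subshift[OF X x h] m by blast
  also have "(\<lambda>n\<in>N. translate h x (ractm m n)) = snd (shift k (N, l))"
  proof -
    have "translate h x (ractm m n) = l (\<phi> (inv k) n)" if n: "n \<in> N" for n
    proof -
      have "ractm m n \<in> M" using act_closed[OF c(1) NM[OF n]] m NM[OF n] by (simp add: ractm_eq)
      moreover have "\<phi> (inv k) n \<in> N" by (rule inv_N[OF ik0 n])
      ultimately show ?thesis using ractm[OF NM[OF n]] by (simp add: translate_def l_def)
    qed
    then show ?thesis by (auto simp: shift_def kN intro: restrict_ext)
  qed
  also have "\<delta> \<dots> = \<delta> l" using inv_\<delta> kH k0 l by blast
  also have "\<dots> = \<Delta> x m'" unfolding l_def using D x m' by simp
  finally show ?thesis unfolding m'_def .
qed

end

section \<open>Compactness and the closed image\<close>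

text \<open>Sequential compactness by a diagonal argument: nested infinite index sets
  \<open>K n\<close> are chosen so that the sequence is constant on \<open>B n\<close> along
  \<open>K n\<close>. Infinitely many good indices per \<open>n\<close> let them be taken
  arbitrarily large.\<close>

lemma finite_pigeonhole_limit:
  fixes x :: "nat \<Rightarrow> 'm \<Rightarrow> 'q"
  assumes B: "\<And>n. finite (B n)" "\<And>n. B n \<subseteq> B (Suc n)"
    and Q: "finite Q" and x: "\<And>k n m. m \<in> B n \<Longrightarrow> x k m \<in> Q"
  obtains z where "\<And>n. infinite {k. \<forall>m\<in>B n. x k m = z m}"
proof -
  define const where
    "const n K \<longleftrightarrow> infinite K \<and> (\<forall>k\<in>K. \<forall>l\<in>K. \<forall>m\<in>B n. x k m = x l m)" for n K
  have refine: "\<exists>K'\<subseteq>K. const n K'" if K: "infinite K" for K n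
  proof -
    have sub: "(\<lambda>k. restrict (x k) (B n)) ` K \<subseteq> B n \<rightarrow>\<^sub>E Q" using x by auto
    have fin: "finite ((\<lambda>k. restrict (x k) (B n)) ` K)"
      by (rule finite_subset[OF sub finite_PiE[OF B(1) Q]])
    obtain a where a: "infinite {k \<in> K. restrict (x k) (B n) = restrict (x a) (B n)}"
      using pigeonhole_infinite[OF K fin] by blast
    then show ?thesis unfolding const_def
      by (intro exI[of _ "{k \<in> K. restrict (x k) (B n) = restrict (x a) (B n)}"])
        (auto simp: restrict_eq_iff)
  qed
  have "\<exists>K. \<forall>n. const n (K n) \<and> K (Suc n) \<subseteq> K n"
  proof (rule dependent_nat_choice)
    show "\<exists>K. const 0 K" using refine[OF infinite_UNIV_nat] by blast
    show "\<exists>K'. const (Suc n) K' \<and> K' \<subseteq> K" if "const n K" for K n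
      using refine[of K "Suc n"] that by (auto simp: const_def)
  qed
  then obtain K where "\<forall>n. const n (K n) \<and> K (Suc n) \<subseteq> K n" by (rule exE)
  then have K: "const n (K n)" "K (Suc n) \<subseteq> K n" for n by simp_all
  have K_anti: "K j \<subseteq> K i" if "i \<le> j" for i j using K(2) that by (rule lift_Suc_antimono_le)
  \<comment> \<open>The limit at \<open>m\<close> is read from any index in the first index set that
    controls \<open>m\<close>; later index sets are subsets, so they give the same value. Outside
    all \<open>B n\<close> the value is arbitrary.\<close>
  define first where "first m = (LEAST n. m \<in> B n)" for m
  define z where "z m = x (SOME k. k \<in> K (first m)) m" for m
  have lim: "x k m = z m" if k: "k \<in> K n" and m: "m \<in> B n" for n k m
  proof -
    have f: "m \<in> B (first m)" "first m \<le> n"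
      unfolding first_def using m by (auto intro: LeastI Least_le)
    have "K (first m) \<noteq> {}" using K(1)[of "first m"] by (auto simp: const_def)
    then have "(SOME k. k \<in> K (first m)) \<in> K (first m)" by (simp add: some_in_eq)
    moreover have "k \<in> K (first m)" using K_anti[OF f(2)] k by blast
    ultimately show ?thesis
      using K(1)[of "first m"] f(1) unfolding z_def const_def by (elim conjE) (drule (1) bspec)+
  qed
  have "K n \<subseteq> {k. \<forall>m\<in>B n. x k m = z m}" for n by (intro subsetI CollectI ballI lim)
  moreover have "infinite (K n)" for n using K(1)[of n] by (simp add: const_def)
  ultimately have "infinite {k. \<forall>m\<in>B n. x k m = z m}" for n by (rule infinite_super)
  then show thesis by (rule that)
qed

context symbolic_cell_space
begin

text \<open>The image of a compact space under a continuous map is closed: preimages approximating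
  \<open>y\<close> on growing balls accumulate at a point \<open>x0\<close> of \<open>X\<close>, and
  finite dependence forces \<open>\<Delta> x0 = y\<close>.\<close>

lemma local_map_image_closed:
  assumes X: "subshift X" and Y: "subshift Y" and loc: "local_at \<kappa> X Y \<Delta>"
    and y: "y \<in> M \<rightarrow>\<^sub>E Q"
    and approx: "\<And>A. finite A \<Longrightarrow> A \<subseteq> M \<Longrightarrow> \<exists>x\<in>X. \<forall>a\<in>A. \<Delta> x a = y a"
  shows "y \<in> \<Delta> ` X"
proof -
  let ?B = "cell_ball m0"
  have mono: "?B n \<subseteq> ?B n'" if "n \<le> n'" for n n' using that by (rule cell_ball_mono)
  have fin: "finite (?B n)" for n by (rule finite_cell_ball[OF origin])
  have "\<forall>n. \<exists>x\<in>X. \<forall>a\<in>?B n. \<Delta> x a = y a"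
    by (intro allI approx fin cell_ball_subset)
  from choice[OF this[unfolded Bex_def]] obtain x where "\<forall>n. x n \<in> X \<and> (\<forall>a\<in>?B n. \<Delta> (x n) a = y a)"
    by (rule exE)
  then have x: "x n \<in> X" "\<forall>a\<in>?B n. \<Delta> (x n) a = y a" for n by simp_all
  have xQ: "x k m \<in> Q" if "m \<in> M" for k m by (rule PiE_mem[OF subshift_config[OF X x(1)] that])
  obtain z where z: "\<And>n. infinite {k. \<forall>m\<in>?B n. x k m = z m}"
  proof (rule finite_pigeonhole_limit[of ?B Q x])
    show "x k m \<in> Q" if "m \<in> ?B n" for k n m using xQ that cell_ball_subset by blast
  qed (use fin mono finite_states in auto)
  define x0 where "x0 = restrict z M"
  \<comment> \<open>The index can be required to be at least \<open>r\<close>, so that the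
    approximant is near \<open>x0\<close> on \<open>A\<close> while its image is already correct on
    the ball of radius \<open>r\<close>.\<close>
  have lim: "\<exists>k\<ge>r. \<forall>a\<in>A. x k a = x0 a" if A: "finite A" "A \<subseteq> M" for A r
  proof -
    obtain n where n: "A \<subseteq> ?B n" using finite_subset_cell_ball[OF A] by blast
    obtain k where "k \<ge> r" "\<forall>m\<in>?B n. x k m = z m"
      using z[of n] unfolding infinite_nat_iff_unbounded_le by blast
    then show ?thesis using n A(2) unfolding x0_def by (metis restrict_apply' subsetD)
  qed
  have "x0 m \<in> Q" if "m \<in> M" for m using lim[of "{m}" 0] xQ[OF that] that by (metis empty_subsetI finite.emptyI finite_insert insertI1 insert_subset)
  then have x0E: "x0 \<in> M \<rightarrow>\<^sub>E Q" by (auto simp: x0_def)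
  have x0: "x0 \<in> X"
    by (rule subshift_closed[OF X x0E]) (use lim x(1) in blast)
  have "\<Delta> x0 m = y m" if m: "m \<in> M" for m
  proof -
    obtain A where A: "finite A" "A \<subseteq> M"
      "\<And>x x'. x \<in> X \<Longrightarrow> x' \<in> X \<Longrightarrow> (\<And>a. a \<in> A \<Longrightarrow> x a = x' a) \<Longrightarrow> \<Delta> x m = \<Delta> x' m"
      using local_map_finite_dependence[OF loc m] by blast
    obtain r where r: "m \<in> ?B r" using cell_ball_exhaust[OF m] by blast
    obtain k where k: "k \<ge> r" "\<forall>a\<in>A. x k a = x0 a" using lim[OF A(1,2)] by blast
    have "\<Delta> x0 m = \<Delta> (x k) m" using k(2) by (intro A(3)[OF x0 x(1)]) simp
    also have "\<dots> = y m" using x(2) mono[OF k(1)] r by blast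
    finally show ?thesis .
  qed
  moreover have "\<Delta> x0 \<in> M \<rightarrow>\<^sub>E Q"
    using loc x0 subshift_config[OF Y] unfolding local_at_def by blast
  ultimately have "\<Delta> x0 = y" using y by (intro PiE_ext) auto
  then show ?thesis using x0 by blast
qed

text \<open>Closedness confines the failure of some \<open>y\<close> outside the image to a finite
  set inside a ball about \<open>m0\<close>. Translating \<open>y\<close> by \<open>coord t\<close>
  moves it to \<open>t\<close> with the same radius, because the image is invariant under
  \<open>H\<close>.\<close>

lemma forbidden_ball_pattern:
  assumes X: "subshift X" and Y: "subshift Y" and loc: "local_at \<kappa> X Y \<Delta>"
    and ne: "\<Delta> ` X \<noteq> Y"
  obtains r where "\<And>t. t \<in> M \<Longrightarrow>
    \<exists>y\<in>Y. \<forall>x\<in>X. restrict (\<Delta> x) (cell_ball t r) \<noteq> restrict y (cell_ball t r)"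
proof -
  interpret group G by (rule group_G)
  have "\<Delta> ` X \<subseteq> Y" using loc unfolding local_at_def by blast
  then obtain y where y: "y \<in> Y" "y \<notin> \<Delta> ` X" using ne by blast
  have "\<exists>A. finite A \<and> A \<subseteq> M \<and> \<not> (\<exists>x\<in>X. \<forall>a\<in>A. \<Delta> x a = y a)"
  proof (rule ccontr)
    assume none: "\<not> ?thesis"
    have "y \<in> \<Delta> ` X"
      by (rule local_map_image_closed[OF X Y loc subshift_config[OF Y y(1)]]) (use none in blast)
    then show False using y(2) by blast
  qed
  then obtain A where "finite A \<and> A \<subseteq> M \<and> \<not> (\<exists>x\<in>X. \<forall>a\<in>A. \<Delta> x a = y a)" by (rule exE)
  then have A: "finite A" "A \<subseteq> M" "\<And>x. x \<in> X \<Longrightarrow> \<exists>a\<in>A. \<Delta> x a \<noteq> y a" by auto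
  obtain r where r: "A \<subseteq> cell_ball m0 r" using finite_subset_cell_ball[OF A(1,2)] by blast
  have "\<exists>y\<in>Y. \<forall>x\<in>X. restrict (\<Delta> x) (cell_ball t r) \<noteq> restrict y (cell_ball t r)"
    if t: "t \<in> M" for t
  proof (intro bexI ballI)
    let ?g = "coord t"
    have gH: "?g \<in> H" by (rule coord_H[OF t])
    have gG: "?g \<in> carrier G" by (rule coord_carrier[OF t])
    show "translate ?g y \<in> Y" by (rule translate_subshift[OF Y y(1) gH])
    fix x assume x: "x \<in> X"
    have gi: "inv ?g \<in> H" by (rule subgroup.m_inv_closed[OF H_subgroup gH])
    \<comment> \<open>A point \<open>x\<close> matching the translated pattern at \<open>t\<close>
      is pulled back to the origin, where its image must differ from \<open>y\<close> at some
      \<open>a\<close>; equivariance carries the difference to \<open>\<phi> ?g a\<close>.\<close>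
    obtain a where a: "a \<in> A" "\<Delta> (translate (inv ?g) x) a \<noteq> y a"
      using A(3)[OF translate_subshift[OF X x gi]] by blast
    have aM: "a \<in> M" using a A by blast
    have "\<Delta> x (\<phi> ?g a) \<noteq> translate ?g y (\<phi> ?g a)"
      using a(2) local_map_equivariant[OF loc X x gi aM] gG act_closed[OF gG aM]
        act_inv_left[OF gG aM] by (simp add: translate_def)
    moreover have "\<phi> ?g a \<in> cell_ball t r"
      using act_cell_ball[OF gG origin, of r] r a(1) coord_origin[OF t] by auto
    ultimately show "restrict (\<Delta> x) (cell_ball t r) \<noteq> restrict (translate ?g y) (cell_ball t r)"
      by (auto simp: restrict_eq_iff)
  qed
  then show thesis by (rule that)
qed

end

section \<open>Counting and entropy\<close>

text \<open>Replacement sends \<open>P\<close> into the set \<open>V\<close> of non-avoiding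
  patterns with at most \<open>K\<close> patterns over each, so
  \<open>card P \<le> K * card V\<close>. The factor \<open>K / (K + 1)\<close> is weaker than the
  \<open>(K - 1) / K\<close> this gives, but it stays positive when \<open>K = 1\<close>, as the
  later logarithm requires.\<close>

lemma card_avoid_step:
  fixes P :: "('m \<Rightarrow> 'q) set"
  assumes A: "finite A" and Q: "finite Q" and P: "P \<subseteq> A \<rightarrow>\<^sub>E Q"
    and E: "E \<subseteq> A" "card Q ^ card E \<le> K"
    and repl: "\<And>q. q \<in> P \<Longrightarrow> \<exists>q'\<in>P. \<not> avoid q' \<and> (\<forall>a\<in>A - E. q' a = q a)"
  shows "(K + 1) * card {q \<in> P. avoid q} \<le> K * card P"
proof -
  define V where "V = {q \<in> P. \<not> avoid q}"
  define fibre where "fibre v = {q \<in> P. \<forall>a\<in>A - E. q a = v a}" for v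
  have finP: "finite P" using finite_subset[OF P finite_PiE[OF A Q]] .
  then have finV: "finite V" by (simp add: V_def)
  have "P \<subseteq> (\<Union>v\<in>V. fibre v)"
  proof
    fix q assume q: "q \<in> P"
    obtain q' where "q' \<in> P" "\<not> avoid q'" "\<forall>a\<in>A - E. q' a = q a" using repl[OF q] by auto
    then have "q' \<in> V" "q \<in> fibre q'" using q by (simp_all add: V_def fibre_def)
    then show "q \<in> (\<Union>v\<in>V. fibre v)" by blast
  qed
  moreover have "finite (\<Union>v\<in>V. fibre v)" using finV finP by (simp add: fibre_def)
  ultimately have "card P \<le> card (\<Union>v\<in>V. fibre v)" by (rule card_mono[rotated])
  also have "\<dots> \<le> (\<Sum>v\<in>V. card (fibre v))" by (rule card_UN_le[OF finV])
  \<comment> \<open>All members of a fibre agree off \<open>E\<close>, so each is determined by its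
    restriction to \<open>E\<close>.\<close>
  also have "\<dots> \<le> (\<Sum>v\<in>V. K)"
  proof (rule sum_mono)
    fix v assume "v \<in> V"
    have "inj_on (\<lambda>q. restrict q E) (fibre v)"
    proof (rule inj_onI)
      fix q q' assume q: "q \<in> fibre v" "q' \<in> fibre v" and eq: "restrict q E = restrict q' E"
      have "q a = q' a" if "a \<in> A" for a
        using q eq that by (cases "a \<in> E") (simp_all add: fibre_def restrict_eq_iff)
      then show "q = q'" using q P by (intro PiE_ext[of q A "\<lambda>_. Q" q']) (auto simp: fibre_def)
    qed
    moreover have "(\<lambda>q. restrict q E) ` fibre v \<subseteq> E \<rightarrow>\<^sub>E Q"
      using P E(1) PiE_mem by (fastforce simp: fibre_def)
    moreover have "finite (E \<rightarrow>\<^sub>E Q)" using finite_PiE[OF finite_subset[OF E(1) A] Q] .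
    ultimately have "card (fibre v) \<le> card (E \<rightarrow>\<^sub>E Q)" by (rule card_inj_on_le)
    also have "\<dots> = card Q ^ card E" using finite_subset[OF E(1) A] by (simp add: card_PiE)
    finally show "card (fibre v) \<le> K" using E(2) by simp
  qed
  finally have "card P \<le> card V * K" by simp
  moreover have "card P = card {q \<in> P. avoid q} + card V"
    unfolding V_def using finP
    by (subst card_Un_disjoint[symmetric]) (auto intro!: arg_cong[of _ _ card])
  ultimately show ?thesis by (simp add: algebra_simps)
qed

text \<open>Induction over \<open>T\<close>, applying the single step to the patterns that already
  avoid at all earlier cells. Disjointness of the sets \<open>E t\<close> makes the constraints
  independent.\<close>

lemma card_avoid_le:
  fixes W :: "('m \<Rightarrow> 'q) set" and p :: "'t \<Rightarrow> 'm \<Rightarrow> 'q"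
  assumes A: "finite A" and Q: "finite Q" and W: "W \<subseteq> A \<rightarrow>\<^sub>E Q" and T: "finite T"
    and E: "\<And>t. t \<in> T \<Longrightarrow> B t \<subseteq> E t \<and> E t \<subseteq> A \<and> card Q ^ card (E t) \<le> K"
    and disj: "\<And>s t. s \<in> T \<Longrightarrow> t \<in> T \<Longrightarrow> s \<noteq> t \<Longrightarrow> E s \<inter> E t = {}"
    and repl: "\<And>q t. q \<in> W \<Longrightarrow> t \<in> T \<Longrightarrow>
      \<exists>q'\<in>W. (\<forall>a\<in>B t. q' a = p t a) \<and> (\<forall>a\<in>A - E t. q' a = q a)"
  shows "(K + 1) ^ card T * card {q \<in> W. \<forall>t\<in>T. \<exists>a\<in>B t. q a \<noteq> p t a} \<le> K ^ card T * card W"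
  using T E disj repl
proof (induction T)
  case (insert t T)
  let ?avoid = "\<lambda>t q. \<exists>a\<in>B t. q a \<noteq> p t a"
  let ?P = "{q \<in> W. \<forall>t\<in>T. ?avoid t q}"
  have "(K + 1) * card {q \<in> ?P. ?avoid t q} \<le> K * card ?P"
  proof (rule card_avoid_step[OF A Q, of _ "E t"])
    show "?P \<subseteq> A \<rightarrow>\<^sub>E Q" using W by blast
    show "E t \<subseteq> A" "card Q ^ card (E t) \<le> K" using insert.prems(1) by auto
    fix q assume q: "q \<in> ?P"
    then obtain q' where q': "q' \<in> W" "\<forall>a\<in>B t. q' a = p t a" "\<forall>a\<in>A - E t. q' a = q a"
      using insert.prems(3)[of q t] by auto
    \<comment> \<open>The change at \<open>t\<close> stays inside \<open>E t\<close>, which misses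
      \<open>E s\<close> and hence \<open>B s\<close>, so the witness of avoidance at
      \<open>s\<close> survives.\<close>
    have "?avoid s q'" if s: "s \<in> T" for s
    proof -
      obtain a where a: "a \<in> B s" "q a \<noteq> p s a" using q s by auto
      have "a \<in> E s" "E s \<subseteq> A" using a(1) insert.prems(1)[of s] s by auto
      moreover have "E s \<inter> E t = {}" using insert.prems(2)[of s t] insert.hyps(2) s by auto
      ultimately have "q' a = q a" using q'(3) by blast
      then show ?thesis using a by (intro bexI[of _ a]) simp_all
    qed
    then have "q' \<in> ?P" using q'(1) by simp
    then show "\<exists>q'\<in>?P. \<not> ?avoid t q' \<and> (\<forall>a\<in>A - E t. q' a = q a)"
      by (rule bexI[rotated]) (simp add: q'(2,3))
  qed
  moreover have "{q \<in> ?P. ?avoid t q} = {q \<in> W. \<forall>t\<in>insert t T. ?avoid t q}" by auto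
  ultimately have step: "(K + 1) * card {q \<in> W. \<forall>t\<in>insert t T. ?avoid t q} \<le> K * card ?P"
    by simp
  have IH: "(K + 1) ^ card T * card ?P \<le> K ^ card T * card W"
    by (rule insert.IH) (use insert.prems in simp_all)
  have "(K + 1) ^ card (insert t T) * card {q \<in> W. \<forall>t\<in>insert t T. ?avoid t q}
      = (K + 1) ^ card T * ((K + 1) * card {q \<in> W. \<forall>t\<in>insert t T. ?avoid t q})"
    using insert.hyps by (simp add: algebra_simps)
  also have "\<dots> \<le> (K + 1) ^ card T * (K * card ?P)" using step by (rule mult_left_mono) simp
  also have "\<dots> = K * ((K + 1) ^ card T * card ?P)" by (simp only: mult.left_commute)
  also have "\<dots> \<le> K * (K ^ card T * card W)" using IH by (rule mult_left_mono) simp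
  also have "\<dots> = K ^ card (insert t T) * card W" using insert.hyps by simp
  finally show ?case .
qed simp

lemma restrictions_subset_PiE: "X \<subseteq> M \<rightarrow>\<^sub>E Q \<Longrightarrow> A \<subseteq> M \<Longrightarrow> restrictions X A \<subseteq> A \<rightarrow>\<^sub>E Q"
  using PiE_mem by (fastforce simp: restrictions_def)

context symbolic_cell_space
begin

section \<open>Strong irreducibility and the local estimate\<close>

lemma allowed_restrict:
  assumes "y \<in> Y" "A \<subseteq> M"
  shows "allowed (A, restrict y A) Y"
proof -
  have "\<forall>a\<in>A. \<phi> \<one> a = a" using act_one assms(2) by blast
  then have "semi_occurs (A, restrict y A) (M, y)"
    unfolding semi_occurs_iff[OF assms(2)] using assms(2) subgroup.one_closed[OF H_subgroup]
    by (intro bexI[of _ "\<one>"]) auto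
  then show ?thesis unfolding allowed_def using assms(1) by blast
qed

text \<open>The annulus of width \<open>\<kappa>\<close> provides the distance that strong
  irreducibility asks for. Since that property concerns finite patterns, the second point is
  prescribed only within the finite set \<open>A\<close>.\<close>

lemma strongly_irreducible_gluing:
  assumes Y: "subshift Y" and irr: "strongly_irreducible_at \<kappa> Y"
    and y: "y \<in> Y" "y' \<in> Y" and t: "t \<in> M" and A: "finite A" "A \<subseteq> M"
  obtains z where "z \<in> Y" "\<forall>a\<in>cell_ball t r. z a = y a"
    "\<forall>a\<in>A - cell_ball t (r + \<kappa>). z a = y' a"
proof -
  let ?B = "cell_ball t r" and ?C = "A - cell_ball t (r + \<kappa>)"
  have CM: "?C \<subseteq> M" using A by auto
  have fp: "(D, restrict u D) \<in> finite_patterns" if "u \<in> Y" "finite D" "D \<subseteq> M" for u D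
    using subshift_config[OF Y that(1)] that by (auto simp: finite_patterns_def)
  have fB: "(?B, restrict y ?B) \<in> finite_patterns"
    by (rule fp[OF y(1) finite_cell_ball[OF t] cell_ball_subset])
  have fC: "(?C, restrict y' ?C) \<in> finite_patterns"
    by (rule fp[OF y(2) _ CM]) (use A(1) in simp)
  have "enat (\<kappa> + 1) \<le> set_dist (fst (?B, restrict y ?B)) (fst (?C, restrict y' ?C))"
    unfolding fst_conv by (rule enat_le_set_dist[OF t order_refl _ CM]) blast
  from irr[unfolded strongly_irreducible_at_def, rule_format, OF fB fC
      allowed_restrict[OF y(1) cell_ball_subset] allowed_restrict[OF y(2) CM] this]
  obtain z where "z \<in> Y" "restrict z ?B = restrict y ?B" "restrict z ?C = restrict y' ?C"
    unfolding fst_conv snd_conv by (elim bexE conjE)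
  then show thesis using that unfolding restrict_eq_iff by blast
qed

lemma local_image_restrictions_le:
  assumes X: "subshift X" and Y: "subshift Y" "Y \<noteq> {}" and irr: "strongly_irreducible_at \<kappa> Y"
    and loc: "local_at \<kappa>' X Y \<Delta>" and ne: "\<Delta> ` X \<noteq> Y"
  obtains K b R :: nat where "K > 0" "b > 0"
    "\<And>A. finite A \<Longrightarrow> A \<subseteq> M \<Longrightarrow> \<exists>n. card (inner R A) \<le> n * b \<and>
      (K + 1) ^ n * card (restrictions (\<Delta> ` X) A) \<le> K ^ n * card (restrictions Y A)"
proof -
  obtain r where r: "\<And>t. t \<in> M \<Longrightarrow>
      \<exists>y\<in>Y. \<forall>x\<in>X. restrict (\<Delta> x) (cell_ball t r) \<noteq> restrict y (cell_ball t r)"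
    using forbidden_ball_pattern[OF X Y(1) loc ne] by metis
  then have "\<forall>t\<in>M. \<exists>y\<in>Y. \<forall>x\<in>X. \<exists>a\<in>cell_ball t r. \<Delta> x a \<noteq> y a"
    by (simp add: restrict_eq_iff)
  from bchoice[OF this[unfolded Bex_def[of Y]]] obtain p
    where "\<forall>t\<in>M. p t \<in> Y \<and> (\<forall>x\<in>X. \<exists>a\<in>cell_ball t r. \<Delta> x a \<noteq> p t a)"
    by (rule exE)
  then have p: "p t \<in> Y" "\<forall>x\<in>X. \<exists>a\<in>cell_ball t r. \<Delta> x a \<noteq> p t a" if "t \<in> M" for t
    using that by simp_all
  \<comment> \<open>The pattern occupies the \<open>r\<close>-ball; the extra
    \<open>\<kappa>\<close> is the margin within which gluing may alter cells.\<close>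
  define R where "R = r + \<kappa>"
  \<comment> \<open>\<open>b \<rho>\<close> bounds the size of every \<open>\<rho>\<close>-ball. It
    is used at \<open>R\<close> to define \<open>K\<close> and at \<open>R + R\<close>, as the
    constant delivered by the lemma, for the packing.\<close>
  define b where "b \<rho> = (\<Sum>k\<le>\<rho>. card S ^ k)" for \<rho>
  have b: "b \<rho> > 0" for \<rho> unfolding b_def by (intro sum_pos2[of _ 0]) auto
  have YQ: "Y \<subseteq> M \<rightarrow>\<^sub>E Q" using subshift_config[OF Y(1)] by blast
  have "Q \<noteq> {}" using Y(2) YQ origin by auto
  then have Q: "card Q > 0" using finite_states by (simp add: card_gt_0_iff)
  define K where "K = card Q ^ b R"
  have count: "\<exists>n. card (inner R A) \<le> n * b (R + R) \<and>
      (K + 1) ^ n * card (restrictions (\<Delta> ` X) A) \<le> K ^ n * card (restrictions Y A)"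
    if A: "finite A" "A \<subseteq> M" for A
  proof -
    obtain T where T: "T \<subseteq> inner R A" "finite T"
      and disj: "\<And>s t. s \<in> T \<Longrightarrow> t \<in> T \<Longrightarrow> s \<noteq> t \<Longrightarrow> cell_ball s R \<inter> cell_ball t R = {}"
      and card: "card (inner R A) \<le> card T * b (R + R)"
      using inner_card_le_packing[OF A, of R] unfolding b_def by blast
    have TA: "t \<in> M" "cell_ball t R \<subseteq> A" if "t \<in> T" for t
      using T(1) that A(2) by (auto simp: inner_def)
    define W where "W = restrictions Y A"
    have W: "W \<subseteq> A \<rightarrow>\<^sub>E Q" unfolding W_def by (rule restrictions_subset_PiE[OF YQ A(2)])
    have "(K + 1) ^ card T * card {q \<in> W. \<forall>t\<in>T. \<exists>a\<in>cell_ball t r. q a \<noteq> p t a}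
        \<le> K ^ card T * card W"
    proof (rule card_avoid_le[OF A(1) finite_states W T(2), where E = "\<lambda>t. cell_ball t R"])
      fix t assume t: "t \<in> T"
      have "card Q ^ card (cell_ball t R) \<le> K"
        unfolding K_def b_def using Q card_cell_ball_le[OF TA(1)[OF t]]
        by (intro power_increasing) auto
      then show "cell_ball t r \<subseteq> cell_ball t R \<and> cell_ball t R \<subseteq> A \<and>
          card Q ^ card (cell_ball t R) \<le> K"
        using cell_ball_mono[of r R t] TA(2)[OF t] by (simp add: R_def)
      fix q assume "q \<in> W"
      then obtain y where y: "y \<in> Y" "q = restrict y A" by (auto simp: W_def restrictions_def)
      obtain z where z: "z \<in> Y" "\<forall>a\<in>cell_ball t r. z a = p t a"
          "\<forall>a\<in>A - cell_ball t R. z a = y a"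
        using strongly_irreducible_gluing[OF Y(1) irr p(1)[OF TA(1)[OF t]] y(1) TA(1)[OF t] A, of r]
        unfolding R_def by metis
      have "cell_ball t r \<subseteq> A" using cell_ball_mono[of r R t] TA(2)[OF t] by (simp add: R_def)
      then have "\<forall>a\<in>cell_ball t r. restrict z A a = p t a" using z(2) by (metis restrict_apply' subsetD)
      moreover have "\<forall>a\<in>A - cell_ball t R. restrict z A a = q a" using z(3) y(2) by simp
      moreover have "restrict z A \<in> W" unfolding W_def restrictions_def by (rule imageI[OF z(1)])
      ultimately show "\<exists>q'\<in>W. (\<forall>a\<in>cell_ball t r. q' a = p t a) \<and> (\<forall>a\<in>A - cell_ball t R. q' a = q a)"
        by (intro bexI conjI)
    qed (rule disj)
    \<comment> \<open>An occurrence of the pattern of \<open>p t\<close> in the image of some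
      \<open>x\<close> is excluded by the choice of \<open>p t\<close>; the \<open>r\<close>-ball
      lies in \<open>A\<close>, so restriction to \<open>A\<close> keeps the witness.\<close>
    moreover have "restrictions (\<Delta> ` X) A
        \<subseteq> {q \<in> W. \<forall>t\<in>T. \<exists>a\<in>cell_ball t r. q a \<noteq> p t a}"
    proof
      fix q assume "q \<in> restrictions (\<Delta> ` X) A"
      then obtain x where x: "x \<in> X" "q = restrict (\<Delta> x) A" by (auto simp: restrictions_def)
      have "\<Delta> x \<in> Y" using loc x(1) unfolding local_at_def by blast
      then have "q \<in> W" unfolding W_def restrictions_def x(2) by (rule imageI)
      moreover have "\<exists>a\<in>cell_ball t r. q a \<noteq> p t a" if t: "t \<in> T" for t
      proof -
        obtain a where a: "a \<in> cell_ball t r" "\<Delta> x a \<noteq> p t a"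
          using p(2)[OF TA(1)[OF t]] x(1) by auto
        have "a \<in> A" using a(1) cell_ball_mono[of r R t] TA(2)[OF t] by (auto simp: R_def)
        then show ?thesis using a x(2) by auto
      qed
      ultimately show "q \<in> {q \<in> W. \<forall>t\<in>T. \<exists>a\<in>cell_ball t r. q a \<noteq> p t a}" by simp
    qed
    then have "card (restrictions (\<Delta> ` X) A)
        \<le> card {q \<in> W. \<forall>t\<in>T. \<exists>a\<in>cell_ball t r. q a \<noteq> p t a}"
      using finite_subset[OF W finite_PiE[OF A(1) finite_states]] by (intro card_mono) simp_all
    then have "(K + 1) ^ card T * card (restrictions (\<Delta> ` X) A)
        \<le> (K + 1) ^ card T * card {q \<in> W. \<forall>t\<in>T. \<exists>a\<in>cell_ball t r. q a \<noteq> p t a}"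
      by (rule mult_left_mono) simp
    ultimately show ?thesis using card unfolding W_def by (meson le_trans)
  qed
  have "K > 0" using Q by (simp add: K_def)
  then show thesis by (rule that[OF _ b count])
qed

end

section \<open>Nets and the strict entropy inequality\<close>

lemma eventually_in_net:
  assumes "directed_set I leq"
  shows "eventually (\<lambda>i. i \<in> I) (net_filter I leq)"
  unfolding eventually_net_filter[OF assms] using assms[unfolded directed_set_def] by blast

lemma net_filter_neq_bot:
  assumes "directed_set I leq"
  shows "net_filter I leq \<noteq> bot"
proof -
  have "\<forall>i\<in>I. leq i i" using assms unfolding directed_set_def by (elim conjE)
  then show ?thesis unfolding trivial_limit_def eventually_net_filter[OF assms] by blast
qed

text \<open>After division by \<open>card (F i)\<close> the linear gap becomes the constant
  \<open>\<delta>\<close>, which passes through the limit superior.\<close>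

lemma entropy_less:
  assumes dir: "directed_set I leq"
    and F: "\<And>i. i \<in> I \<Longrightarrow> finite (F i) \<and> F i \<noteq> {} \<and> F i \<subseteq> M"
    and Q: "finite Q" and Z: "Z \<noteq> {}" "Z \<subseteq> M \<rightarrow>\<^sub>E Q" and \<delta>: "\<delta> > 0"
    and gap: "eventually (\<lambda>i. ln (real (card (restrictions Z (F i)))) + \<delta> * real (card (F i))
      \<le> ln (real (card (restrictions Y (F i))))) (net_filter I leq)"
    and Y: "Z \<subseteq> Y" "Y \<subseteq> M \<rightarrow>\<^sub>E Q"
  shows "entropy I leq F Z < entropy I leq F Y"
proof -
  let ?N = "net_filter I leq"
  let ?e = "\<lambda>X i. log_nat (card (restrictions X (F i))) / ereal (real (card (F i)))"
  note inI = eventually_in_net[OF dir]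
  note nt = net_filter_neq_bot[OF dir]
  have fin: "finite (restrictions X (F i))" "card (restrictions X (F i)) \<le> card Q ^ card (F i)"
    if "i \<in> I" "X \<subseteq> M \<rightarrow>\<^sub>E Q" for X i
  proof -
    have sub: "restrictions X (F i) \<subseteq> F i \<rightarrow>\<^sub>E Q"
      using restrictions_subset_PiE[OF that(2)] F[OF that(1)] by simp
    have fE: "finite (F i \<rightarrow>\<^sub>E Q)" using F[OF that(1)] Q by (intro finite_PiE) auto
    show "finite (restrictions X (F i))" by (rule finite_subset[OF sub fE])
    show "card (restrictions X (F i)) \<le> card Q ^ card (F i)"
      using card_mono[OF fE sub] F[OF that(1)] by (simp add: card_PiE)
  qed
  have pos: "0 < card (restrictions X (F i))" if "i \<in> I" "X \<subseteq> M \<rightarrow>\<^sub>E Q" "X \<noteq> {}" for X i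
    using fin(1)[OF that(1,2)] that(3) by (simp add: card_gt_0_iff restrictions_def)
  have e: "?e X i = ereal (ln (real (card (restrictions X (F i)))) / real (card (F i)))"
    if "i \<in> I" "X \<subseteq> M \<rightarrow>\<^sub>E Q" "X \<noteq> {}" for X i
    using pos[OF that] F[OF that(1)] by (simp add: log_nat_def)
  have Fpos: "0 < real (card (F i))" if "i \<in> I" for i
    using F[OF that] by (simp add: card_gt_0_iff)
  have "0 \<le> Limsup ?N (?e Z)"
  proof (rule le_Limsup[OF nt eventually_mono[OF inI]])
    fix i assume i: "i \<in> I"
    show "0 \<le> ?e Z i" unfolding e[OF i Z(2,1)] using pos[OF i Z(2,1)] by simp
  qed
  moreover have "Limsup ?N (?e Z) \<le> ereal (ln (real (card Q)))"
  proof (rule Limsup_bounded[OF eventually_mono[OF inI]])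
    fix i assume i: "i \<in> I"
    have c: "0 < card (restrictions Z (F i))" "card (restrictions Z (F i)) \<le> card Q ^ card (F i)"
      using pos[OF i Z(2,1)] fin(2)[OF i Z(2)] by auto
    then have cQ: "0 < card Q" using Fpos[OF i] by (cases "card Q = 0") (auto simp: power_0_left)
    have "ln (real (card (restrictions Z (F i)))) \<le> ln (real (card Q) ^ card (F i))"
      using c cQ by (subst ln_le_cancel_iff) (simp_all flip: of_nat_power)
    also have "\<dots> = real (card (F i)) * ln (real (card Q))" using cQ by (simp add: ln_realpow)
    finally show "?e Z i \<le> ereal (ln (real (card Q)))"
      unfolding e[OF i Z(2,1)] using Fpos[OF i] by (simp add: field_simps)
  qed
  \<comment> \<open>In the extended reals adding \<open>\<delta>\<close> is a strict increase only
    at finite values; this is why both bounds on the limit superior were established.\<close>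
  ultimately have finite: "\<bar>Limsup ?N (?e Z)\<bar> \<noteq> \<infinity>" by auto
  have "Limsup ?N (?e Z) < Limsup ?N (?e Z) + ereal \<delta>"
    using finite \<delta> by (cases "Limsup ?N (?e Z)") auto
  also have "\<dots> = Limsup ?N (\<lambda>i. ?e Z i + ereal \<delta>)"
    by (rule Limsup_add_ereal_right[OF nt, symmetric]) simp
  also have "\<dots> \<le> Limsup ?N (?e Y)"
  proof (rule Limsup_mono, rule eventually_mono[OF eventually_conj[OF inI gap]], elim conjE)
    fix i assume i: "i \<in> I" and g: "ln (real (card (restrictions Z (F i)))) + \<delta> * real (card (F i))
      \<le> ln (real (card (restrictions Y (F i))))"
    have ne: "Y \<noteq> {}" using Z(1) Y(1) by blast
    show "?e Z i + ereal \<delta> \<le> ?e Y i"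
      unfolding e[OF i Z(2,1)] e[OF i Y(2) ne]
      using divide_right_mono[OF g, of "real (card (F i))"] Fpos[OF i]
      by (simp add: add_divide_distrib)
  qed
  finally show ?thesis unfolding entropy_def .
qed

theorem theorem4p1:
  fixes G :: "('g, 'r) monoid_scheme"
    and M :: "'m set" and \<phi> :: "'g \<Rightarrow> 'm \<Rightarrow> 'm"
    and m0 :: 'm and coord :: "'m \<Rightarrow> 'g"
    and S :: "'g set set" and H :: "'g set" and Q :: "'q set"
    and I :: "'i set" and leq :: "'i \<Rightarrow> 'i \<Rightarrow> bool" and F :: "'i \<Rightarrow> 'm set"
    and X Y :: "('m \<Rightarrow> 'q) set" and \<Delta> :: "('m \<Rightarrow> 'q) \<Rightarrow> ('m \<Rightarrow> 'q)"
  assumes "symbolic_cell_space G M \<phi> m0 coord S H Q"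
    and "cell_space.right_amenable G M \<phi> m0 coord"
    and "generated_cell_space.right_folner_net G M \<phi> m0 coord S I leq F"
    and "infinite M"
    and "symbolic_cell_space.subshift G M \<phi> H Q X" and "X \<noteq> {}"
    and "symbolic_cell_space.subshift G M \<phi> H Q Y"
    and "symbolic_cell_space.strongly_irreducible G M \<phi> m0 coord S H Q Y"
    and "symbolic_cell_space.local_map G M \<phi> m0 coord S H Q X Y \<Delta>"
    and "\<Delta> ` X \<noteq> Y"
  shows "entropy I leq F (\<Delta> ` X) < entropy I leq F Y"
proof -
  interpret symbolic_cell_space G M \<phi> m0 coord S H Q by (rule assms(1))
  note X = assms(5) and Y = assms(7)
  obtain \<kappa> where irr: "strongly_irreducible_at \<kappa> Y"
    using assms(8) unfolding strongly_irreducible_def by blast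
  obtain \<kappa>' where loc: "local_at \<kappa>' X Y \<Delta>" using assms(9) unfolding local_map_def by blast
  have \<Delta>Y: "\<Delta> ` X \<subseteq> Y" using loc unfolding local_at_def by blast
  then have Yne: "Y \<noteq> {}" using assms(6) by blast
  have YQ: "Y \<subseteq> M \<rightarrow>\<^sub>E Q" using subshift_config[OF Y] by blast
  obtain K b R :: nat where K: "K > 0" and b: "b > 0"
    and count: "\<And>A. finite A \<Longrightarrow> A \<subseteq> M \<Longrightarrow> \<exists>n. card (inner R A) \<le> n * b \<and>
      (K + 1) ^ n * card (restrictions (\<Delta> ` X) A) \<le> K ^ n * card (restrictions Y A)"
    by (rule local_image_restrictions_le[OF X Y Yne irr loc assms(10)]) (rule that)
  have dir: "directed_set I leq"
    and F: "\<And>i. i \<in> I \<Longrightarrow> finite (F i) \<and> F i \<noteq> {} \<and> F i \<subseteq> M"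
    and lim: "((\<lambda>i. real (card (cell_boundary R (F i))) / real (card (F i))) \<longlongrightarrow> 0) (net_filter I leq)"
    using assms(3) unfolding right_folner_net_def by auto
  \<comment> \<open>The logarithmic cost of forbidding the pattern at one cell of the
    packing.\<close>
  define \<gamma> where "\<gamma> = ln (real (K + 1)) - ln (real K)"
  have \<gamma>: "\<gamma> > 0" using K by (simp add: \<gamma>_def)
  note inI = eventually_in_net[OF dir]
  \<comment> \<open>With less than half of \<open>F i\<close> in the boundary, more than half of its
    cells are inner.\<close>
  have small: "eventually (\<lambda>i. real (card (cell_boundary R (F i))) / real (card (F i)) < 1 / 2)
      (net_filter I leq)"
    using lim by (rule order_tendstoD) simp
  have "eventually (\<lambda>i. ln (real (card (restrictions (\<Delta> ` X) (F i)))) +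
      \<gamma> / (2 * real b) * real (card (F i)) \<le> ln (real (card (restrictions Y (F i)))))
      (net_filter I leq)"
  proof (rule eventually_mono[OF eventually_conj[OF inI small]], elim conjE)
    fix i assume i: "i \<in> I"
      and bd: "real (card (cell_boundary R (F i))) / real (card (F i)) < 1 / 2"
    define z where "z = card (restrictions (\<Delta> ` X) (F i))"
    define y where "y = card (restrictions Y (F i))"
    have Fi: "finite (F i)" "F i \<noteq> {}" "F i \<subseteq> M" using F[OF i] by auto
    obtain n where n: "card (inner R (F i)) \<le> n * b" "(K + 1) ^ n * z \<le> K ^ n * y"
      using count[OF Fi(1,3)] unfolding z_def y_def by blast
    have fin: "finite (restrictions X' (F i))" if "X' \<subseteq> M \<rightarrow>\<^sub>E Q" for X'
      by (rule finite_subset[OF restrictions_subset_PiE[OF that Fi(3)]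
            finite_PiE[OF Fi(1) finite_states]])
    have z: "z > 0" unfolding z_def using fin[OF subset_trans[OF \<Delta>Y YQ]] assms(6)
      by (simp add: card_gt_0_iff restrictions_def)
    have y: "y > 0" unfolding y_def using fin[OF YQ] Yne
      by (simp add: card_gt_0_iff restrictions_def)
    have "card (F i) \<le> n * b + card (cell_boundary R (F i))"
      using card_le_inner_plus_boundary[OF Fi(1,3), of R] n(1) by linarith
    then have "real (card (F i)) \<le> real n * real b + real (card (cell_boundary R (F i)))"
      by (metis of_nat_add of_nat_le_iff of_nat_mult)
    moreover have "real (card (cell_boundary R (F i))) < real (card (F i)) / 2"
      using bd Fi(1,2) by (simp add: field_simps card_gt_0_iff)
    \<comment> \<open>The boundary term, below half of \<open>card (F i)\<close>, is absorbed on the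
      left; the resulting factor 2 is the one in the gap
      \<open>\<gamma> / (2 * real b)\<close>.\<close>
    ultimately have "real (card (F i)) \<le> 2 * real b * real n" by (simp add: algebra_simps)
    then have "\<gamma> * real (card (F i)) \<le> \<gamma> * (2 * real b * real n)"
      using \<gamma> by (intro mult_left_mono) auto
    then have "\<gamma> / (2 * real b) * real (card (F i)) \<le> \<gamma> * real n"
      using b by (simp add: field_simps)
    moreover have "ln (real z) + \<gamma> * real n \<le> ln (real y)"
    proof -
      have "real (K + 1) ^ n * real z \<le> real K ^ n * real y"
        using n(2) by (metis of_nat_le_iff of_nat_mult of_nat_power)
      then have "ln (real (K + 1) ^ n * real z) \<le> ln (real K ^ n * real y)"
        using K z y by (subst ln_le_cancel_iff) auto
      then have "real n * ln (real (K + 1)) + ln (real z) \<le> real n * ln (real K) + ln (real y)"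
        using K z y by (simp add: ln_mult ln_realpow)
      then show ?thesis by (simp add: \<gamma>_def algebra_simps)
    qed
    ultimately show "ln (real (card (restrictions (\<Delta> ` X) (F i)))) +
        \<gamma> / (2 * real b) * real (card (F i)) \<le> ln (real (card (restrictions Y (F i))))"
      unfolding z_def y_def by linarith
  qed
  then show ?thesis
    using assms(6) \<Delta>Y YQ \<gamma> b
    by (intro entropy_less[OF dir F finite_states, where \<delta> = "\<gamma> / (2 * real b)"]) auto
qed

end
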